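(* Let $\Lambda$ be a semiring. Let $E: A \xrightarrow{\varkappa} B \xrightarrow{\sigma} G$ be a Schreier short exact sequence of chain complexes of $\Lambda$-semimodules and their morphisms, where $A=\{A_n,d_n^+,d_n^-\}$, $B=\{B_n,\partial_n^+,\partial_n^-\}$, and $G=\{G_n,\delta_n\}$ is an ordinary chain complex (regarded as the chain complex $\{G_n,\delta_n,0\}$). Suppose that each $A_n$ is a cancellative $\Lambda$-semimodule, every differential $\partial_n^-$ of $B$ preserves representatives, and each $G_n$ is a $\Lambda$-module. Then the long homology sequence $$\cdots\to H_{n+1}(G)\xrightarrow{\partial_{n+1}(E)}H_n(A)\xrightarrow{H_n(\varkappa)}H_n(B)\xrightarrow{H_n(\sigma)}H_n(G)\xrightarrow{\partial_n(E)}H_{n-1}(A)\to\cdots$$ is, for every $n\in\mathbb{Z}$, exact at $H_n(A)$ and at $H_n(B)$; moreover $H_n(\sigma)(H_n(B))\subset\operatorname{Ker}(\partial_n(E))$, and $H_n(\varkappa)$ is normal. Furthermore, the sequence is exact at $H_n(G)$ if and only if $H_n(\sigma)(H_n(B))=H_n(K(\sigma))(H_n(K(B)))$ (as subsets of $H_n(G)=H_n(K(G))$).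
   Context: Semimodules. A semiring $\Lambda=(\Lambda,+,0,\cdot,1)$ has $(\Lambda,+,0)$ an abelian monoid, $(\Lambda,\cdot,1)$ a monoid, two-sided distributivity, and $\lambda\cdot 0=0\cdot\lambda=0$. A (left) $\Lambda$-semimodule is an abelian monoid $A$ with an action $\Lambda\times A\to A$ that is additive in each variable, with $(\lambda\lambda')a=\lambda(\lambda' a)$, $1a=a$, $0a=0$. A $\Lambda$-homomorphism is an additive map $f$ with $f(\lambda a)=\lambda f(a)$. $\operatorname{Ker}(f)=\{a: f(a)=0\}$. $A$ is cancellative if $a+a'=a+a''$ implies $a'=a''$; $A$ is a $\Lambda$-module if $(A,+)$ is a group. A sequence $X\xrightarrow{\alpha}Y\xrightarrow{\beta}Z$ of $\Lambda$-homomorphisms is exact (at $Y$) if $\alpha(X)=\operatorname{Ker}(\beta)$. A $\Lambda$-homomorphism $\varphi:A\to B$ is normal if whenever $\varphi(a_1)=\varphi(a_2)$ there are $\kappa_1,\kappa_2\in\operatorname{Ker}(\varphi)$ with $\kappa_1+a_1=\kappa_2+a_2$. Completion. $K(A)$ is the group completion of $A$ (classes $[a_1,a_2]$ of pairs, with $[u,v]=[x,y]$ iff $u+y+z=v+x+z$ for some $z$); it is a module over the ring completion $K(\Lambda)$. $k_A:A\to K(A)$, $k_A(a)=[a,0]$, is the canonical homomorphism, and $K(f)([a_1,a_2])=[f(a_1),f(a_2)]$. If $A$ is a $\Lambda$-module, then $K(A)$ is identified with $A$ via $k_A$. Chain complexes. A chain complex $X=\{X_n,\partial_n^+,\partial_n^-\}_{n\in\mathbb{Z}}$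 consists of $\Lambda$-semimodules $X_n$ and $\Lambda$-homomorphisms $\partial_n^+,\partial_n^-:X_n\to X_{n-1}$ with $\partial_n^+\partial_{n+1}^++\partial_n^-\partial_{n+1}^-=\partial_n^+\partial_{n+1}^-+\partial_n^-\partial_{n+1}^+$ for all $n$. Put $Z_n(X)=\{x\in X_n:\partial_n^+(x)=\partial_n^-(x)\}$ and $H_n(X)=Z_n(X)/\rho_n(X)$, where $x\,\rho_n(X)\,y$ iff $x+\partial_{n+1}^+(u)+\partial_{n+1}^-(v)=y+\partial_{n+1}^+(v)+\partial_{n+1}^-(u)$ for some $u,v\in X_{n+1}$; $\operatorname{cl}(x)$ denotes the class of $x$. An ordinary chain complex $\{C_n,\partial_n\}$ (with $\partial_n\partial_{n+1}=0$) is identified with $\{C_n,\partial_n,0\}$. A morphism $f=\{f_n\}:X\to X'$ is a sequence of $\Lambda$-homomorphisms $f_n:X_n\to X'_n$ with $\partial_n'^+f_n+f_{n-1}\partial_n^-=\partial_n'^-f_n+f_{n-1}\partial_n^+$ for all $n$. Whenever $f_n(Z_n(X))\subset Z_n(X')$ and $\operatorname{cl}(x)\mapsto\operatorname{cl}(f_n(x))$ is well defined, this map is a $\Lambda$-homomorphism denoted $H_n(f):H_n(X)\to H_n(X')$ (in the present setting $H_n(\varkappa)$ and $H_n(\sigma)$ are defined for all $n$). For a chain complex $X$, $K(X)=\{K(X_n),K(\partial_n^+)-K(\partial_n^-)\}$ is an ordinary chain complex of modules, and for a morphism $f$, $K(f)=\{K(f_n)\}$ is a usual chain map. When all $G_n$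 are modules, $H_n(G)=H_n(K(G))$. Schreier extensions. A sequence $A\xrightarrow{\lambda}B\xrightarrow{\tau}C$ of $\Lambda$-homomorphisms is a Schreier extension of $A$ by $C$ if $\lambda$ is injective, $\tau$ is surjective, $\lambda(A)=\operatorname{Ker}(\tau)$, and for every $c\in C$ the set $\tau^{-1}(c)$ contains an element $u_c$ (called a representative) such that every $b\in\tau^{-1}(c)$ can be written $b=\lambda(a)+u_c$ for a unique $a\in A$. A Schreier short exact sequence of chain complexes $E:A\xrightarrow{\varkappa}B\xrightarrow{\sigma}C$ is a sequence of chain complexes and morphisms such that each $E_n:A_n\xrightarrow{\varkappa_n}B_n\xrightarrow{\sigma_n}C_n$ is a Schreier extension. The differential $\partial_n^-:B_n\to B_{n-1}$ preserves representatives if it maps every representative of $E_n$ to a representative of $E_{n-1}$. Connecting homomorphism. In the present setting, $\partial_n(E):H_n(G)\to H_{n-1}(A)$ is defined by $\partial_n(E)(\operatorname{cl}(c))=\operatorname{cl}(a)$, where $c\in Z_n(G)$, $u_c\in B_n$ is a representative of $E_n$ with $\sigma_n(u_c)=c$, and $a\in Z_{n-1}(A)$ is the element with $\partial_n^+(u_c)=\varkappa_{n-1}(a)+\partial_n^-(u_c)$; this is a well-defined $\Lambda$-homomorphism. *)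

theory Defs
  imports "HOL-Algebra.Module" "HOL-Algebra.AbelCoset"
begin

text \<open>
  Semimodules reuse the record type of \<open>HOL-Algebra.Module\<close>; its fields \<open>mult\<close> and \<open>one\<close> are
  irrelevant. The law \<open>r \<odot> \<zero> = \<zero>\<close> is not an axiom because it follows from \<open>\<zero> \<odot> x = \<zero>\<close>; for the
  same reason homomorphisms are not required to preserve \<open>\<zero>\<close>.
\<close>

locale semimodule = R?: semiring R + M?: abelian_monoid M
  for R (structure) and M (structure) +
  assumes smult_closed [simp, intro]:
      "\<lbrakk>r \<in> carrier R; x \<in> carrier M\<rbrakk> \<Longrightarrow> r \<odot>\<^bsub>M\<^esub> x \<in> carrier M"
    and smult_l_distr:
      "\<lbrakk>r \<in> carrier R; s \<in> carrier R; x \<in> carrier M\<rbrakk> \<Longrightarrow>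
        (r \<oplus> s) \<odot>\<^bsub>M\<^esub> x = r \<odot>\<^bsub>M\<^esub> x \<oplus>\<^bsub>M\<^esub> s \<odot>\<^bsub>M\<^esub> x"
    and smult_r_distr:
      "\<lbrakk>r \<in> carrier R; x \<in> carrier M; y \<in> carrier M\<rbrakk> \<Longrightarrow>
        r \<odot>\<^bsub>M\<^esub> (x \<oplus>\<^bsub>M\<^esub> y) = r \<odot>\<^bsub>M\<^esub> x \<oplus>\<^bsub>M\<^esub> r \<odot>\<^bsub>M\<^esub> y"
    and smult_assoc1:
      "\<lbrakk>r \<in> carrier R; s \<in> carrier R; x \<in> carrier M\<rbrakk> \<Longrightarrow>
        (r \<otimes> s) \<odot>\<^bsub>M\<^esub> x = r \<odot>\<^bsub>M\<^esub> (s \<odot>\<^bsub>M\<^esub> x)"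
    and smult_one [simp]: "x \<in> carrier M \<Longrightarrow> \<one> \<odot>\<^bsub>M\<^esub> x = x"
    and smult_l_null [simp]: "x \<in> carrier M \<Longrightarrow> \<zero> \<odot>\<^bsub>M\<^esub> x = \<zero>\<^bsub>M\<^esub>"

definition semimodule_hom ::
    "('r, 'm) ring_scheme \<Rightarrow> ('r, 'a) module \<Rightarrow> ('r, 'b) module \<Rightarrow> ('a \<Rightarrow> 'b) set" where
  "semimodule_hom R M N = {f. f \<in> carrier M \<rightarrow> carrier N \<and>
     (\<forall>x\<in>carrier M. \<forall>y\<in>carrier M. f (x \<oplus>\<^bsub>M\<^esub> y) = f x \<oplus>\<^bsub>N\<^esub> f y) \<and>
     (\<forall>r\<in>carrier R. \<forall>x\<in>carrier M. f (r \<odot>\<^bsub>M\<^esub> x) = r \<odot>\<^bsub>N\<^esub> f x)}"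

lemma semimodule_hom_zero:
  assumes "semimodule R M" "semimodule R N" "f \<in> semimodule_hom R M N"
  shows "f \<zero>\<^bsub>M\<^esub> = \<zero>\<^bsub>N\<^esub>"
proof -
  interpret M: semimodule R M by fact
  interpret N: semimodule R N by fact
  have "f \<zero>\<^bsub>M\<^esub> = f (\<zero>\<^bsub>R\<^esub> \<odot>\<^bsub>M\<^esub> \<zero>\<^bsub>M\<^esub>)" by simp
  also have "\<dots> = \<zero>\<^bsub>R\<^esub> \<odot>\<^bsub>N\<^esub> f \<zero>\<^bsub>M\<^esub>"
    using assms(3) unfolding semimodule_hom_def by (auto simp del: M.smult_l_null)
  also have "\<dots> = \<zero>\<^bsub>N\<^esub>" using assms(3) M.M.zero_closed by (intro N.smult_l_null) (auto simp: semimodule_hom_def)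
  finally show ?thesis .
qed

definition cancellative :: "('r, 'a) module \<Rightarrow> bool" where
  "cancellative M \<longleftrightarrow> (\<forall>a\<in>carrier M. \<forall>a'\<in>carrier M. \<forall>a''\<in>carrier M.
     a \<oplus>\<^bsub>M\<^esub> a' = a \<oplus>\<^bsub>M\<^esub> a'' \<longrightarrow> a' = a'')"

definition exact_at ::
    "('r, 'm) ring_scheme \<Rightarrow> ('r, 'a) module \<Rightarrow> ('r, 'b) module \<Rightarrow> ('r, 'c) module \<Rightarrow>
     ('a \<Rightarrow> 'b) \<Rightarrow> ('b \<Rightarrow> 'c) \<Rightarrow> bool" where
  "exact_at R X Y Z \<alpha> \<beta> \<longleftrightarrow> \<alpha> \<in> semimodule_hom R X Y \<and> \<beta> \<in> semimodule_hom R Y Z \<and>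
     \<alpha> ` carrier X = a_kernel Y Z \<beta>"

definition normal_hom ::
    "('r, 'm) ring_scheme \<Rightarrow> ('r, 'a) module \<Rightarrow> ('r, 'b) module \<Rightarrow> ('a \<Rightarrow> 'b) \<Rightarrow> bool" where
  "normal_hom R A B \<phi> \<longleftrightarrow> \<phi> \<in> semimodule_hom R A B \<and>
     (\<forall>a1\<in>carrier A. \<forall>a2\<in>carrier A. \<phi> a1 = \<phi> a2 \<longrightarrow>
       (\<exists>k1\<in>a_kernel A B \<phi>. \<exists>k2\<in>a_kernel A B \<phi>. k1 \<oplus>\<^bsub>A\<^esub> a1 = k2 \<oplus>\<^bsub>A\<^esub> a2))"


section \<open>Chain complexes and homology\<close>

text \<open>\<open>dplus X n\<close> and \<open>dminus X n\<close> are the differentials from degree \<open>n\<close> to degree \<open>n - 1\<close>.\<close>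

record ('r, 'a) semi_complex =
  obj :: "int \<Rightarrow> ('r, 'a) module"
  dplus :: "int \<Rightarrow> 'a \<Rightarrow> 'a"
  dminus :: "int \<Rightarrow> 'a \<Rightarrow> 'a"

definition chain_complex :: "('r, 'm) ring_scheme \<Rightarrow> ('r, 'a) semi_complex \<Rightarrow> bool" where
  "chain_complex R X \<longleftrightarrow>
     (\<forall>n. semimodule R (obj X n) \<and>
        dplus X n \<in> semimodule_hom R (obj X n) (obj X (n - 1)) \<and>
        dminus X n \<in> semimodule_hom R (obj X n) (obj X (n - 1)) \<and>
        (\<forall>x\<in>carrier (obj X (n + 1)).
           dplus X n (dplus X (n + 1) x) \<oplus>\<^bsub>obj X (n - 1)\<^esub> dminus X n (dminus X (n + 1) x)
         = dplus X n (dminus X (n + 1) x) \<oplus>\<^bsub>obj X (n - 1)\<^esub> dminus X n (dplus X (n + 1) x)))"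

definition ordinary_chain_complex ::
    "('r, 'm) ring_scheme \<Rightarrow> (int \<Rightarrow> ('r, 'a) module) \<Rightarrow> (int \<Rightarrow> 'a \<Rightarrow> 'a) \<Rightarrow> bool" where
  "ordinary_chain_complex R C d \<longleftrightarrow>
     (\<forall>n. semimodule R (C n) \<and> d n \<in> semimodule_hom R (C n) (C (n - 1)) \<and>
        (\<forall>x\<in>carrier (C (n + 1)). d n (d (n + 1) x) = \<zero>\<^bsub>C (n - 1)\<^esub>))"

definition complex_of ::
    "(int \<Rightarrow> ('r, 'a) module) \<Rightarrow> (int \<Rightarrow> 'a \<Rightarrow> 'a) \<Rightarrow> ('r, 'a) semi_complex" where
  "complex_of C d = \<lparr>obj = C, dplus = d, dminus = (\<lambda>n x. \<zero>\<^bsub>C (n - 1)\<^esub>)\<rparr>"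

definition cycles :: "('r, 'a) semi_complex \<Rightarrow> int \<Rightarrow> 'a set" where
  "cycles X n = {x \<in> carrier (obj X n). dplus X n x = dminus X n x}"

definition homologous :: "('r, 'a) semi_complex \<Rightarrow> int \<Rightarrow> ('a \<times> 'a) set" where
  "homologous X n = {(x, y). x \<in> cycles X n \<and> y \<in> cycles X n \<and>
     (\<exists>u\<in>carrier (obj X (n + 1)). \<exists>v\<in>carrier (obj X (n + 1)).
        x \<oplus>\<^bsub>obj X n\<^esub> dplus X (n + 1) u \<oplus>\<^bsub>obj X n\<^esub> dminus X (n + 1) v
      = y \<oplus>\<^bsub>obj X n\<^esub> dplus X (n + 1) v \<oplus>\<^bsub>obj X n\<^esub> dminus X (n + 1) u)}"

context
  fixes R :: "('r, 'm) ring_scheme" and X :: "('r, 'a) semi_complex"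
  assumes X: "chain_complex R X"
begin

lemma semimodule_obj: "semimodule R (obj X n)" using X by (simp add: chain_complex_def)
lemma differential_hom: "dplus X n \<in> semimodule_hom R (obj X n) (obj X (n - 1))"
     "dminus X n \<in> semimodule_hom R (obj X n) (obj X (n - 1))" using X by (simp_all add: chain_complex_def)

lemma differential_hom_Suc: "dplus X (n+1) \<in> semimodule_hom R (obj X (n+1)) (obj X n)"
     "dminus X (n+1) \<in> semimodule_hom R (obj X (n+1)) (obj X n)" using differential_hom[of "n+1"] by simp_all

lemma equiv_homologous: "equiv (cycles X n) (homologous X n)"
proof -
  interpret M: semimodule R "obj X n" by (rule semimodule_obj)
  interpret N: semimodule R "obj X (n+1)" by (rule semimodule_obj)
  let ?A = "carrier (obj X n)" let ?B = "carrier (obj X (n+1))"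
  have C: "dplus X (n+1) u \<in> ?A" "dminus X (n+1) u \<in> ?A" if "u \<in> ?B" for u
    using differential_hom_Suc[of n] that by (auto simp: semimodule_hom_def)
  have P: "dplus X (n+1) (u \<oplus>\<^bsub>obj X (n+1)\<^esub> v) = dplus X (n+1) u \<oplus>\<^bsub>obj X n\<^esub> dplus X (n+1) v"
     "dminus X (n+1) (u \<oplus>\<^bsub>obj X (n+1)\<^esub> v) = dminus X (n+1) u \<oplus>\<^bsub>obj X n\<^esub> dminus X (n+1) v"
    if "u \<in> ?B" "v \<in> ?B" for u v
    using differential_hom_Suc[of n] that by (auto simp: semimodule_hom_def)
  have cy: "x \<in> ?A" if "x \<in> cycles X n" for x using that by (simp add: cycles_def)
  show ?thesis
  proof (rule equivI)
    show "homologous X n \<subseteq> cycles X n \<times> cycles X n" by (auto simp: homologous_def)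
    show "refl_on (cycles X n) (homologous X n)"
      by (auto simp: refl_on_def homologous_def intro!: bexI[of _ "\<zero>\<^bsub>obj X (n+1)\<^esub>"])
    show "sym (homologous X n)" by (rule symI) (force simp: homologous_def)
    show "trans (homologous X n)"
    proof (rule transI)
      fix x y z assume "(x, y) \<in> homologous X n" "(y, z) \<in> homologous X n"
      then obtain u v u' v' where h: "x \<in> cycles X n" "y \<in> cycles X n" "z \<in> cycles X n"
        "u \<in> ?B" "v \<in> ?B" "u' \<in> ?B" "v' \<in> ?B"
        and e: "x \<oplus>\<^bsub>obj X n\<^esub> dplus X (n + 1) u \<oplus>\<^bsub>obj X n\<^esub> dminus X (n + 1) v
      = y \<oplus>\<^bsub>obj X n\<^esub> dplus X (n + 1) v \<oplus>\<^bsub>obj X n\<^esub> dminus X (n + 1) u"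
      "y \<oplus>\<^bsub>obj X n\<^esub> dplus X (n + 1) u' \<oplus>\<^bsub>obj X n\<^esub> dminus X (n + 1) v'
      = z \<oplus>\<^bsub>obj X n\<^esub> dplus X (n + 1) v' \<oplus>\<^bsub>obj X n\<^esub> dminus X (n + 1) u'"
        by (auto simp: homologous_def)
      note h' = h(4-) cy[OF h(1)] cy[OF h(2)] cy[OF h(3)]
      have "x \<oplus>\<^bsub>obj X n\<^esub> dplus X (n + 1) (u \<oplus>\<^bsub>obj X (n+1)\<^esub> u') \<oplus>\<^bsub>obj X n\<^esub> dminus X (n + 1) (v \<oplus>\<^bsub>obj X (n+1)\<^esub> v')
        = (x \<oplus>\<^bsub>obj X n\<^esub> dplus X (n + 1) u \<oplus>\<^bsub>obj X n\<^esub> dminus X (n + 1) v) \<oplus>\<^bsub>obj X n\<^esub> (dplus X (n + 1) u' \<oplus>\<^bsub>obj X n\<^esub> dminus X (n + 1) v')"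
        using h' by (simp add: P C M.a_ac)
      also have "\<dots> = (y \<oplus>\<^bsub>obj X n\<^esub> dplus X (n + 1) u' \<oplus>\<^bsub>obj X n\<^esub> dminus X (n + 1) v') \<oplus>\<^bsub>obj X n\<^esub> (dplus X (n + 1) v \<oplus>\<^bsub>obj X n\<^esub> dminus X (n + 1) u)"
        unfolding e(1) using h' by (simp add: P C M.a_ac)
      also have "\<dots> = z \<oplus>\<^bsub>obj X n\<^esub> dplus X (n + 1) (v \<oplus>\<^bsub>obj X (n+1)\<^esub> v') \<oplus>\<^bsub>obj X n\<^esub> dminus X (n + 1) (u \<oplus>\<^bsub>obj X (n+1)\<^esub> u')"
        unfolding e(2) using h' by (simp add: P C M.a_ac)
      finally show "(x, z) \<in> homologous X n" unfolding homologous_def using h N.a_closed by blast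
    qed
  qed
qed

end

definition hcl :: "('r, 'a) semi_complex \<Rightarrow> int \<Rightarrow> 'a \<Rightarrow> 'a set" where
  "hcl X n x = homologous X n `` {x}"

text \<open>
  Functions on quotients are written as unions over the representatives of a class, as in
  \<open>HOL.Equiv_Relations\<close>: when the value does not depend on the representative, all members of the
  union coincide with it.
\<close>

definition homology :: "('r, 'a) semi_complex \<Rightarrow> int \<Rightarrow> ('r, 'a set) module" where
  "homology X n = \<lparr>carrier = cycles X n // homologous X n,
     mult = undefined, one = undefined,
     zero = hcl X n \<zero>\<^bsub>obj X n\<^esub>,
     add = (\<lambda>c c'. \<Union>x\<in>c. \<Union>y\<in>c'. hcl X n (x \<oplus>\<^bsub>obj X n\<^esub> y)),
     smult = (\<lambda>r c. \<Union>x\<in>c. hcl X n (r \<odot>\<^bsub>obj X n\<^esub> x))\<rparr>"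

definition chain_morphism ::
    "('r, 'm) ring_scheme \<Rightarrow> ('r, 'a) semi_complex \<Rightarrow> ('r, 'b) semi_complex \<Rightarrow>
     (int \<Rightarrow> 'a \<Rightarrow> 'b) \<Rightarrow> bool" where
  "chain_morphism R X X' f \<longleftrightarrow>
     (\<forall>n. f n \<in> semimodule_hom R (obj X n) (obj X' n) \<and>
        (\<forall>x\<in>carrier (obj X n).
           dplus X' n (f n x) \<oplus>\<^bsub>obj X' (n - 1)\<^esub> f (n - 1) (dminus X n x)
         = dminus X' n (f n x) \<oplus>\<^bsub>obj X' (n - 1)\<^esub> f (n - 1) (dplus X n x)))"

text \<open>
  \<open>homology_map X' n f\<close> sends \<open>hcl X n x\<close> to \<open>hcl X' n (f n x)\<close>. The source complex enters only
  through the classes to which the map is applied.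
\<close>

definition homology_map ::
    "('s, 'b) semi_complex \<Rightarrow> int \<Rightarrow> (int \<Rightarrow> 'a \<Rightarrow> 'b) \<Rightarrow> 'a set \<Rightarrow> 'b set" where
  "homology_map X' n f c = (\<Union>x\<in>c. hcl X' n (f n x))"


lemma homology_map_hcl:
  assumes X: "chain_complex R X" and X': "chain_complex S X'"
    and "\<And>y z. (y, z) \<in> homologous X n \<Longrightarrow> (f n y, f n z) \<in> homologous X' n"
    and x: "x \<in> cycles X n"
  shows "homology_map X' n f (hcl X n x) = hcl X' n (f n x)"
proof -
  have "congruent (homologous X n) (\<lambda>y. hcl X' n (f n y))"
    unfolding hcl_def using assms(3) by (intro congruentI equiv_class_eq[OF equiv_homologous[OF X']])
  from UN_equiv_class[OF equiv_homologous[OF X] this x] show ?thesis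
    by (simp add: homology_map_def hcl_def)
qed


section \<open>Group completion\<close>

definition K_rel :: "('a, 'm) ring_scheme \<Rightarrow> (('a \<times> 'a) \<times> ('a \<times> 'a)) set" where
  "K_rel A = {((u, v), (x, y)). {u, v, x, y} \<subseteq> carrier A \<and>
     (\<exists>z\<in>carrier A. u \<oplus>\<^bsub>A\<^esub> y \<oplus>\<^bsub>A\<^esub> z = v \<oplus>\<^bsub>A\<^esub> x \<oplus>\<^bsub>A\<^esub> z)}"

definition K_cl :: "('a, 'm) ring_scheme \<Rightarrow> 'a \<Rightarrow> 'a \<Rightarrow> ('a \<times> 'a) set" where
  "K_cl A a1 a2 = K_rel A `` {(a1, a2)}"

definition K_ring :: "('r, 'm) ring_scheme \<Rightarrow> ('r \<times> 'r) set ring" where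
  "K_ring R = \<lparr>carrier = (carrier R \<times> carrier R) // K_rel R,
     mult = (\<lambda>c c'. \<Union>(a1, a2)\<in>c. \<Union>(b1, b2)\<in>c'.
       K_cl R (a1 \<otimes>\<^bsub>R\<^esub> b1 \<oplus>\<^bsub>R\<^esub> a2 \<otimes>\<^bsub>R\<^esub> b2) (a1 \<otimes>\<^bsub>R\<^esub> b2 \<oplus>\<^bsub>R\<^esub> a2 \<otimes>\<^bsub>R\<^esub> b1)),
     one = K_cl R \<one>\<^bsub>R\<^esub> \<zero>\<^bsub>R\<^esub>,
     zero = K_cl R \<zero>\<^bsub>R\<^esub> \<zero>\<^bsub>R\<^esub>,
     add = (\<lambda>c c'. \<Union>(a1, a2)\<in>c. \<Union>(b1, b2)\<in>c'. K_cl R (a1 \<oplus>\<^bsub>R\<^esub> b1) (a2 \<oplus>\<^bsub>R\<^esub> b2))\<rparr>"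

text \<open>\<open>K_module A\<close> has scalars in \<open>K_ring R\<close>, where \<open>R\<close> is the semiring acting on \<open>A\<close>.\<close>

definition K_module :: "('r, 'a) module \<Rightarrow> (('r \<times> 'r) set, ('a \<times> 'a) set) module" where
  "K_module A = \<lparr>carrier = (carrier A \<times> carrier A) // K_rel A,
     mult = undefined, one = undefined,
     zero = K_cl A \<zero>\<^bsub>A\<^esub> \<zero>\<^bsub>A\<^esub>,
     add = (\<lambda>c c'. \<Union>(a1, a2)\<in>c. \<Union>(b1, b2)\<in>c'. K_cl A (a1 \<oplus>\<^bsub>A\<^esub> b1) (a2 \<oplus>\<^bsub>A\<^esub> b2)),
     smult = (\<lambda>l c. \<Union>(l1, l2)\<in>l. \<Union>(a1, a2)\<in>c.
       K_cl A (l1 \<odot>\<^bsub>A\<^esub> a1 \<oplus>\<^bsub>A\<^esub> l2 \<odot>\<^bsub>A\<^esub> a2) (l1 \<odot>\<^bsub>A\<^esub> a2 \<oplus>\<^bsub>A\<^esub> l2 \<odot>\<^bsub>A\<^esub> a1))\<rparr>"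

lemma K_rel_iff: "((u, v), (x, y)) \<in> K_rel A \<longleftrightarrow> {u, v, x, y} \<subseteq> carrier A \<and>
     (\<exists>z\<in>carrier A. u \<oplus>\<^bsub>A\<^esub> y \<oplus>\<^bsub>A\<^esub> z = v \<oplus>\<^bsub>A\<^esub> x \<oplus>\<^bsub>A\<^esub> z)"
  by (simp add: K_rel_def)

lemma (in abelian_monoid) equiv_K_rel: "equiv (carrier G \<times> carrier G) (K_rel G)"
proof (rule equivI)
  show "K_rel G \<subseteq> (carrier G \<times> carrier G) \<times> (carrier G \<times> carrier G)"
    by (auto simp: K_rel_def)
  show "refl_on (carrier G \<times> carrier G) (K_rel G)"
    by (auto simp: refl_on_def K_rel_def a_ac)
  show "sym (K_rel G)"
  proof (rule symI, clarify)
    fix u v x y assume "((u, v), (x, y)) \<in> K_rel G"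
    then obtain z where z: "u \<in> carrier G" "v \<in> carrier G" "x \<in> carrier G" "y \<in> carrier G"
      "z \<in> carrier G" "u \<oplus> y \<oplus> z = v \<oplus> x \<oplus> z" by (auto simp: K_rel_iff)
    have "x \<oplus> v \<oplus> z = y \<oplus> u \<oplus> z" using z by (simp add: a_comm)
    with z show "((x, y), (u, v)) \<in> K_rel G" by (auto simp: K_rel_iff)
  qed
  show "trans (K_rel G)"
  proof (rule transI, clarify)
    fix u v x y s t assume "((u, v), (x, y)) \<in> K_rel G" "((x, y), (s, t)) \<in> K_rel G"
    then obtain z w where z: "u \<in> carrier G" "v \<in> carrier G" "x \<in> carrier G" "y \<in> carrier G"
      "s \<in> carrier G" "t \<in> carrier G" "z \<in> carrier G" "w \<in> carrier G"
      "u \<oplus> y \<oplus> z = v \<oplus> x \<oplus> z" "x \<oplus> t \<oplus> w = y \<oplus> s \<oplus> w" by (auto simp: K_rel_iff)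
    have "u \<oplus> t \<oplus> (x \<oplus> y \<oplus> z \<oplus> w) = (u \<oplus> y \<oplus> z) \<oplus> (x \<oplus> t \<oplus> w)" using z(1-8) by (simp add: a_ac)
    also have "\<dots> = (v \<oplus> x \<oplus> z) \<oplus> (y \<oplus> s \<oplus> w)" using z by simp
    also have "\<dots> = v \<oplus> s \<oplus> (x \<oplus> y \<oplus> z \<oplus> w)" using z(1-8) by (simp add: a_ac)
    finally show "((u, v), (s, t)) \<in> K_rel G" using z(1-8) by (auto simp: K_rel_iff)
  qed
qed

lemma K_cl_bilinear:
  fixes A :: "('a, 'm) ring_scheme" and B :: "('b, 'n) ring_scheme" and C :: "('c, 'k) ring_scheme"
  assumes A: "abelian_monoid A" and B: "abelian_monoid B" and C: "abelian_monoid C"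
    and cl: "\<And>a b. a \<in> carrier A \<Longrightarrow> b \<in> carrier B \<Longrightarrow> f a b \<in> carrier C"
    and l: "\<And>a a' b. a \<in> carrier A \<Longrightarrow> a' \<in> carrier A \<Longrightarrow> b \<in> carrier B \<Longrightarrow>
       f (a \<oplus>\<^bsub>A\<^esub> a') b = f a b \<oplus>\<^bsub>C\<^esub> f a' b"
    and r: "\<And>a b' b. a \<in> carrier A \<Longrightarrow> b \<in> carrier B \<Longrightarrow> b' \<in> carrier B \<Longrightarrow>
       f a (b \<oplus>\<^bsub>B\<^esub> b') = f a b \<oplus>\<^bsub>C\<^esub> f a b'"
    and m: "a1 \<in> carrier A" "a2 \<in> carrier A" "b1 \<in> carrier B" "b2 \<in> carrier B"
  shows "(\<Union>(a1, a2)\<in>K_cl A a1 a2. \<Union>(b1, b2)\<in>K_cl B b1 b2.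
     K_cl C (f a1 b1 \<oplus>\<^bsub>C\<^esub> f a2 b2) (f a1 b2 \<oplus>\<^bsub>C\<^esub> f a2 b1)) =
     K_cl C (f a1 b1 \<oplus>\<^bsub>C\<^esub> f a2 b2) (f a1 b2 \<oplus>\<^bsub>C\<^esub> f a2 b1)"
proof -
  interpret A: abelian_monoid A by fact
  interpret B: abelian_monoid B by fact
  interpret C: abelian_monoid C by fact
  let ?f = "\<lambda>p q. K_cl C (f (fst p) (fst q) \<oplus>\<^bsub>C\<^esub> f (snd p) (snd q)) (f (fst p) (snd q) \<oplus>\<^bsub>C\<^esub> f (snd p) (fst q))"
  have "congruent2 (K_rel A) (K_rel B) ?f"
  proof (rule congruent2I[OF A.equiv_K_rel B.equiv_K_rel])
    fix p q r assume "(p, q) \<in> K_rel A" and rr: "r \<in> carrier B \<times> carrier B"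
    then obtain u v x y z where z: "p = (u, v)" "q = (x, y)" "u \<in> carrier A" "v \<in> carrier A" "x \<in> carrier A" "y \<in> carrier A"
      "z \<in> carrier A" "u \<oplus>\<^bsub>A\<^esub> y \<oplus>\<^bsub>A\<^esub> z = v \<oplus>\<^bsub>A\<^esub> x \<oplus>\<^bsub>A\<^esub> z" by (cases p; cases q) (auto simp: K_rel_iff)
    obtain c d where r': "r = (c, d)" "c \<in> carrier B" "d \<in> carrier B" using rr by auto
    have "(f u c \<oplus>\<^bsub>C\<^esub> f v d) \<oplus>\<^bsub>C\<^esub> (f x d \<oplus>\<^bsub>C\<^esub> f y c) \<oplus>\<^bsub>C\<^esub> (f z c \<oplus>\<^bsub>C\<^esub> f z d)
      = f (u \<oplus>\<^bsub>A\<^esub> y \<oplus>\<^bsub>A\<^esub> z) c \<oplus>\<^bsub>C\<^esub> f (v \<oplus>\<^bsub>A\<^esub> x \<oplus>\<^bsub>A\<^esub> z) d"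
      using z(3-7) r' by (simp add: l cl C.a_ac)
    also have "\<dots> = f (v \<oplus>\<^bsub>A\<^esub> x \<oplus>\<^bsub>A\<^esub> z) c \<oplus>\<^bsub>C\<^esub> f (u \<oplus>\<^bsub>A\<^esub> y \<oplus>\<^bsub>A\<^esub> z) d" using z by simp
    also have "\<dots> = (f u d \<oplus>\<^bsub>C\<^esub> f v c) \<oplus>\<^bsub>C\<^esub> (f x c \<oplus>\<^bsub>C\<^esub> f y d) \<oplus>\<^bsub>C\<^esub> (f z c \<oplus>\<^bsub>C\<^esub> f z d)"
      using z(3-7) r' by (simp add: l cl C.a_ac)
    finally have "((f u c \<oplus>\<^bsub>C\<^esub> f v d, f u d \<oplus>\<^bsub>C\<^esub> f v c), (f x c \<oplus>\<^bsub>C\<^esub> f y d, f x d \<oplus>\<^bsub>C\<^esub> f y c)) \<in> K_rel C"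
      using z(3-7) r' cl by (auto simp: K_rel_iff)
    then show "?f p r = ?f q r" unfolding z r' K_cl_def by (auto intro!: equiv_class_eq[OF C.equiv_K_rel])
  next
    fix p q r assume "(p, q) \<in> K_rel B" and rr: "r \<in> carrier A \<times> carrier A"
    then obtain u v x y z where z: "p = (u, v)" "q = (x, y)" "u \<in> carrier B" "v \<in> carrier B" "x \<in> carrier B" "y \<in> carrier B"
      "z \<in> carrier B" "u \<oplus>\<^bsub>B\<^esub> y \<oplus>\<^bsub>B\<^esub> z = v \<oplus>\<^bsub>B\<^esub> x \<oplus>\<^bsub>B\<^esub> z" by (cases p; cases q) (auto simp: K_rel_iff)
    obtain c d where r': "r = (c, d)" "c \<in> carrier A" "d \<in> carrier A" using rr by auto
    have "(f c u \<oplus>\<^bsub>C\<^esub> f d v) \<oplus>\<^bsub>C\<^esub> (f c y \<oplus>\<^bsub>C\<^esub> f d x) \<oplus>\<^bsub>C\<^esub> (f c z \<oplus>\<^bsub>C\<^esub> f d z)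
      = f c (u \<oplus>\<^bsub>B\<^esub> y \<oplus>\<^bsub>B\<^esub> z) \<oplus>\<^bsub>C\<^esub> f d (v \<oplus>\<^bsub>B\<^esub> x \<oplus>\<^bsub>B\<^esub> z)"
      using z(3-7) r' by (simp add: r cl C.a_ac)
    also have "\<dots> = f c (v \<oplus>\<^bsub>B\<^esub> x \<oplus>\<^bsub>B\<^esub> z) \<oplus>\<^bsub>C\<^esub> f d (u \<oplus>\<^bsub>B\<^esub> y \<oplus>\<^bsub>B\<^esub> z)" using z by simp
    also have "\<dots> = (f c v \<oplus>\<^bsub>C\<^esub> f d u) \<oplus>\<^bsub>C\<^esub> (f c x \<oplus>\<^bsub>C\<^esub> f d y) \<oplus>\<^bsub>C\<^esub> (f c z \<oplus>\<^bsub>C\<^esub> f d z)"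
      using z(3-7) r' by (simp add: r cl C.a_ac)
    finally have "((f c u \<oplus>\<^bsub>C\<^esub> f d v, f c v \<oplus>\<^bsub>C\<^esub> f d u), (f c x \<oplus>\<^bsub>C\<^esub> f d y, f c y \<oplus>\<^bsub>C\<^esub> f d x)) \<in> K_rel C"
      using z(3-7) r' cl by (auto simp: K_rel_iff)
    then show "?f r p = ?f r q" unfolding z r' K_cl_def by (auto intro!: equiv_class_eq[OF C.equiv_K_rel])
  qed
  from UN_equiv_class2[OF A.equiv_K_rel B.equiv_K_rel this, of "(a1,a2)" "(b1,b2)"] m
  show ?thesis by (simp add: K_cl_def case_prod_beta)
qed

lemma (in abelian_monoid) K_cl_add:
  assumes "a1 \<in> carrier G" "a2 \<in> carrier G" "b1 \<in> carrier G" "b2 \<in> carrier G"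
  shows "(\<Union>(a1, a2)\<in>K_cl G a1 a2. \<Union>(b1, b2)\<in>K_cl G b1 b2. K_cl G (a1 \<oplus> b1) (a2 \<oplus> b2))
     = K_cl G (a1 \<oplus> b1) (a2 \<oplus> b2)"
proof -
  let ?f = "\<lambda>p q. K_cl G (fst p \<oplus> fst q) (snd p \<oplus> snd q)"
  have "congruent2 (K_rel G) (K_rel G) ?f"
  proof (rule congruent2_commuteI[OF equiv_K_rel])
    fix p q r assume "(p, q) \<in> K_rel G" and rr: "r \<in> carrier G \<times> carrier G"
    then obtain u v x y z where z: "p = (u, v)" "q = (x, y)" "u \<in> carrier G" "v \<in> carrier G" "x \<in> carrier G" "y \<in> carrier G"
      "z \<in> carrier G" "u \<oplus> y \<oplus> z = v \<oplus> x \<oplus> z" by (cases p; cases q) (auto simp: K_rel_iff)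
    obtain c d where r': "r = (c, d)" "c \<in> carrier G" "d \<in> carrier G" using rr by auto
    have "(c \<oplus> u) \<oplus> (d \<oplus> y) \<oplus> z = c \<oplus> d \<oplus> (u \<oplus> y \<oplus> z)" using z(3-7) r' by (simp add: a_ac)
    also have "\<dots> = (d \<oplus> v) \<oplus> (c \<oplus> x) \<oplus> z" using z r' by (simp add: a_ac)
    finally show "?f r p = ?f r q" unfolding z r' K_cl_def using z(3-7) r'
      by (auto intro!: equiv_class_eq[OF equiv_K_rel] simp: K_rel_iff)
  qed (auto simp: a_comm)
  from UN_equiv_class2[OF equiv_K_rel equiv_K_rel this, of "(a1,a2)" "(b1,b2)"] assms
  show ?thesis by (simp add: K_cl_def case_prod_beta)
qed

lemma mem_K_carrier_iff: "c \<in> (carrier A \<times> carrier A) // K_rel A \<longleftrightarrow>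
   (\<exists>a1\<in>carrier A. \<exists>a2\<in>carrier A. c = K_cl A a1 a2)"
  by (auto simp: quotient_def K_cl_def)

lemma (in semiring) K_ring_mult_cl:
  assumes "a1 \<in> carrier R" "a2 \<in> carrier R" "b1 \<in> carrier R" "b2 \<in> carrier R"
  shows "K_cl R a1 a2 \<otimes>\<^bsub>K_ring R\<^esub> K_cl R b1 b2 = K_cl R (a1 \<otimes> b1 \<oplus> a2 \<otimes> b2) (a1 \<otimes> b2 \<oplus> a2 \<otimes> b1)"
  unfolding K_ring_def using K_cl_bilinear[OF abelian_monoid_axioms abelian_monoid_axioms abelian_monoid_axioms,
     where f = "mult R"] assms
  by (simp add: l_distr r_distr)

lemma (in abelian_monoid) K_cl_eqI:
  assumes "a \<in> carrier G" "b \<in> carrier G" "c \<in> carrier G" "d \<in> carrier G" "a \<oplus> d = b \<oplus> c"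
  shows "K_cl G a b = K_cl G c d"
  unfolding K_cl_def using assms by (auto intro!: equiv_class_eq[OF equiv_K_rel] bexI[of _ \<zero>] simp: K_rel_iff)

lemma (in semiring) ring_K_ring: "ring (K_ring R)"
proof -
  have c: "x \<in> carrier (K_ring R) \<longleftrightarrow> (\<exists>a1\<in>carrier R. \<exists>a2\<in>carrier R. x = K_cl R a1 a2)" for x
    by (simp add: K_ring_def mem_K_carrier_iff)
  have a: "K_cl R a1 a2 \<oplus>\<^bsub>K_ring R\<^esub> K_cl R b1 b2 = K_cl R (a1 \<oplus> b1) (a2 \<oplus> b2)"
    if "a1 \<in> carrier R" "a2 \<in> carrier R" "b1 \<in> carrier R" "b2 \<in> carrier R" for a1 a2 b1 b2
    using K_cl_add[OF that] by (simp add: K_ring_def)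
  have z: "\<zero>\<^bsub>K_ring R\<^esub> = K_cl R \<zero> \<zero>" "\<one>\<^bsub>K_ring R\<^esub> = K_cl R \<one> \<zero>" by (auto simp: K_ring_def)
  note d = l_distr r_distr m_assoc a_ac
  show ?thesis
  proof (rule ringI)
    show "abelian_group (K_ring R)"
      apply (rule abelian_groupI)
           apply (fastforce simp: c a)
          apply (auto simp: c z)[1]
         apply (auto simp: c a a_ac)[1]
        apply (auto simp: c a a_ac)[1]
       apply (auto simp: c a z)[1]
      apply (clarsimp simp: c)
      subgoal for a b using K_cl_eqI[of "b \<oplus> a" "a \<oplus> b" \<zero> \<zero>]
        by (intro bexI[of _ "K_cl R b a"]) (simp add: a z a_comm, auto simp: c)
      done
    show "monoid (K_ring R)"
      apply (rule monoidI)
          apply (fastforce simp: c K_ring_mult_cl)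
         apply (fastforce simp: c z)
        apply (auto simp: c K_ring_mult_cl d)[1]
       apply (auto simp: c K_ring_mult_cl z)[1]
      apply (auto simp: c K_ring_mult_cl z)[1]
      done
  qed (auto simp: c a K_ring_mult_cl d)
qed

lemma semimodule_K_module:
  fixes R (structure) and M :: "('r, 'a) module" 
  assumes "semimodule R M" shows "semimodule (K_ring R) (K_module M)"
proof -
  interpret semimodule R M by fact
  have c: "x \<in> carrier (K_ring R) \<longleftrightarrow> (\<exists>a1\<in>carrier R. \<exists>a2\<in>carrier R. x = K_cl R a1 a2)" for x
    by (simp add: K_ring_def mem_K_carrier_iff)
  have a: "K_cl R a1 a2 \<oplus>\<^bsub>K_ring R\<^esub> K_cl R b1 b2 = K_cl R (a1 \<oplus> b1) (a2 \<oplus> b2)"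
    if "a1 \<in> carrier R" "a2 \<in> carrier R" "b1 \<in> carrier R" "b2 \<in> carrier R" for a1 a2 b1 b2
    using R.K_cl_add[OF that] by (simp add: K_ring_def)
  have z: "\<zero>\<^bsub>K_ring R\<^esub> = K_cl R \<zero> \<zero>" "\<one>\<^bsub>K_ring R\<^esub> = K_cl R \<one> \<zero>" by (auto simp: K_ring_def)
  have c': "x \<in> carrier (K_module M) \<longleftrightarrow> (\<exists>a1\<in>carrier M. \<exists>a2\<in>carrier M. x = K_cl M a1 a2)" for x
    by (simp add: K_module_def mem_K_carrier_iff)
  have a': "K_cl M a1 a2 \<oplus>\<^bsub>K_module M\<^esub> K_cl M b1 b2 = K_cl M (a1 \<oplus>\<^bsub>M\<^esub> b1) (a2 \<oplus>\<^bsub>M\<^esub> b2)"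
    if "a1 \<in> carrier M" "a2 \<in> carrier M" "b1 \<in> carrier M" "b2 \<in> carrier M" for a1 a2 b1 b2
    using M.K_cl_add[OF that] by (simp add: K_module_def)
  have z': "\<zero>\<^bsub>K_module M\<^esub> = K_cl M \<zero>\<^bsub>M\<^esub> \<zero>\<^bsub>M\<^esub>" by (auto simp: K_module_def)
  have s: "K_cl R a1 a2 \<odot>\<^bsub>K_module M\<^esub> K_cl M b1 b2 =
    K_cl M (a1 \<odot>\<^bsub>M\<^esub> b1 \<oplus>\<^bsub>M\<^esub> a2 \<odot>\<^bsub>M\<^esub> b2) (a1 \<odot>\<^bsub>M\<^esub> b2 \<oplus>\<^bsub>M\<^esub> a2 \<odot>\<^bsub>M\<^esub> b1)"
    if "a1 \<in> carrier R" "a2 \<in> carrier R" "b1 \<in> carrier M" "b2 \<in> carrier M" for a1 a2 b1 b2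
    using K_cl_bilinear[OF R.abelian_monoid_axioms M.abelian_monoid_axioms M.abelian_monoid_axioms, where f = "smult M", OF smult_closed smult_l_distr smult_r_distr] that
    by (simp add: K_module_def)
  note d = smult_l_distr smult_r_distr smult_assoc1 M.a_ac R.K_ring_mult_cl
  interpret KR: ring "K_ring R" by (rule R.ring_K_ring)
  have "abelian_group (K_module M)"
      apply (rule abelian_groupI)
           apply (fastforce simp: c' a')
          apply (auto simp: c' z')[1]
         apply (auto simp: c' a' M.a_ac)[1]
        apply (auto simp: c' a' M.a_ac)[1]
       apply (auto simp: c' a' z')[1]
      apply (clarsimp simp: c')
      subgoal for a b using M.K_cl_eqI[of "b \<oplus>\<^bsub>M\<^esub> a" "a \<oplus>\<^bsub>M\<^esub> b" "\<zero>\<^bsub>M\<^esub>" "\<zero>\<^bsub>M\<^esub>"]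
        by (intro bexI[of _ "K_cl M b a"]) (simp add: a' z' M.a_comm, auto simp: c')
      done
  then interpret KM: abelian_group "K_module M" .
  show ?thesis
    apply (unfold_locales)
    apply (fastforce simp: c c' s)
    apply (auto simp: c c' s a a' d)[1]
    apply (auto simp: c c' s a a' d)[1]
    apply (auto simp: c c' s a a' d)[1]
    apply (auto simp: c c' s a a' d z)[1]
    apply (auto simp: c c' s a a' d z z')[1]
    done
qed

definition K_unit :: "('a, 'm) ring_scheme \<Rightarrow> 'a \<Rightarrow> ('a \<times> 'a) set" where
  "K_unit A a = K_cl A a \<zero>\<^bsub>A\<^esub>"

definition K_map :: "('b, 'm) ring_scheme \<Rightarrow> ('a \<Rightarrow> 'b) \<Rightarrow> ('a \<times> 'a) set \<Rightarrow> ('b \<times> 'b) set" where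
  "K_map B f c = (\<Union>(a1, a2)\<in>c. K_cl B (f a1) (f a2))"

definition K_complex ::
    "('r, 'a) semi_complex \<Rightarrow> (('r \<times> 'r) set, ('a \<times> 'a) set) semi_complex" where
  "K_complex X = complex_of (\<lambda>n. K_module (obj X n))
     (\<lambda>n c. K_map (obj X (n - 1)) (dplus X n) c
        \<ominus>\<^bsub>K_module (obj X (n - 1))\<^esub> K_map (obj X (n - 1)) (dminus X n) c)"


section \<open>Schreier extensions\<close>

definition representative ::
    "('r, 'a) module \<Rightarrow> ('r, 'b) module \<Rightarrow> ('a \<Rightarrow> 'b) \<Rightarrow> ('b \<Rightarrow> 'c) \<Rightarrow> 'b \<Rightarrow> bool" where
  "representative A B l t u \<longleftrightarrow> u \<in> carrier B \<and>
     (\<forall>b\<in>carrier B. t b = t u \<longrightarrow> (\<exists>!a. a \<in> carrier A \<and> b = l a \<oplus>\<^bsub>B\<^esub> u))"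

definition schreier_extension ::
    "('r, 'm) ring_scheme \<Rightarrow> ('r, 'a) module \<Rightarrow> ('r, 'b) module \<Rightarrow> ('r, 'c) module \<Rightarrow>
     ('a \<Rightarrow> 'b) \<Rightarrow> ('b \<Rightarrow> 'c) \<Rightarrow> bool" where
  "schreier_extension R A B C l t \<longleftrightarrow>
     semimodule R A \<and> semimodule R B \<and> semimodule R C \<and>
     l \<in> semimodule_hom R A B \<and> t \<in> semimodule_hom R B C \<and>
     inj_on l (carrier A) \<and> t ` carrier B = carrier C \<and> l ` carrier A = a_kernel B C t \<and>
     (\<forall>c\<in>carrier C. \<exists>u. t u = c \<and> representative A B l t u)"

definition schreier_ses ::
    "('r, 'm) ring_scheme \<Rightarrow> ('r, 'a) semi_complex \<Rightarrow> ('r, 'b) semi_complex \<Rightarrow>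
     ('r, 'c) semi_complex \<Rightarrow> (int \<Rightarrow> 'a \<Rightarrow> 'b) \<Rightarrow> (int \<Rightarrow> 'b \<Rightarrow> 'c) \<Rightarrow> bool" where
  "schreier_ses R A B C \<kappa> \<sigma> \<longleftrightarrow>
     chain_complex R A \<and> chain_complex R B \<and> chain_complex R C \<and>
     chain_morphism R A B \<kappa> \<and> chain_morphism R B C \<sigma> \<and>
     (\<forall>n. schreier_extension R (obj A n) (obj B n) (obj C n) (\<kappa> n) (\<sigma> n))"

definition dminus_preserves_representatives ::
    "('r, 'a) semi_complex \<Rightarrow> ('r, 'b) semi_complex \<Rightarrow> (int \<Rightarrow> 'a \<Rightarrow> 'b) \<Rightarrow>
     (int \<Rightarrow> 'b \<Rightarrow> 'c) \<Rightarrow> int \<Rightarrow> bool" where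
  "dminus_preserves_representatives A B \<kappa> \<sigma> n \<longleftrightarrow>
     (\<forall>u. representative (obj A n) (obj B n) (\<kappa> n) (\<sigma> n) u \<longrightarrow>
        representative (obj A (n - 1)) (obj B (n - 1)) (\<kappa> (n - 1)) (\<sigma> (n - 1)) (dminus B n u))"

text \<open>
  The union runs over all choices entering the construction of \<open>\<partial>\<^sub>n(E)\<close>: a cycle \<open>c\<close> in the given
  class, a representative \<open>u\<close> over it, and the element \<open>a\<close> so determined.
\<close>

definition connecting ::
    "('r, 'a) semi_complex \<Rightarrow> ('r, 'b) semi_complex \<Rightarrow> (int \<Rightarrow> 'a \<Rightarrow> 'b) \<Rightarrow>
     (int \<Rightarrow> 'b \<Rightarrow> 'c) \<Rightarrow> int \<Rightarrow> 'c set \<Rightarrow> 'a set" where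
  "connecting A B \<kappa> \<sigma> n C = \<Union>{hcl A (n - 1) a | c u a.
     c \<in> C \<and> representative (obj A n) (obj B n) (\<kappa> n) (\<sigma> n) u \<and> \<sigma> n u = c \<and>
     a \<in> cycles A (n - 1) \<and>
     dplus B n u = \<kappa> (n - 1) a \<oplus>\<^bsub>obj B (n - 1)\<^esub> dminus B n u}"

end

theory Submission
  imports Defs
begin

text \<open>
  Subtraction is not available in the \<open>B\<^sub>n\<close>, so the usual diagram chase is carried out with pairs.
  A pair \<open>(q, p)\<close> of elements of \<open>B\<^sub>n\<close> stands for the difference \<open>q - p\<close> in the completion
  \<open>K(B\<^sub>n)\<close>, and \<open>lift n q p a a'\<close> says, in terms of \<open>B\<close> alone, that the boundary of \<open>q - p\<close> in
  \<open>K(B)\<close> is \<open>\<kappa>(a - a')\<close>. No information is lost by passing between \<open>B\<close> and \<open>K(B)\<close>, because \<open>B\<^sub>n\<close>,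
  an extension of the cancellative \<open>A\<^sub>n\<close> by the group \<open>G\<^sub>n\<close>, is cancellative
  (\<open>B_cancellative\<close>).

  Everything rests on \<open>lifts_agree\<close>: if two pairs lie over classes of \<open>G\<^sub>n\<close> that differ by a
  boundary, then the elements of \<open>A\<close> that describe their boundaries are homologous. The reason is that two elements
  of \<open>B\<^sub>n\<close> in the same fibre of \<open>\<sigma>\<close> agree after adding elements of \<open>\<kappa>(A\<^sub>n)\<close>, which is where
  representatives enter. Consequently the connecting homomorphism can be computed from any pair
  \<open>(q, p)\<close> with \<open>lift n q p a \<zero>\<close>, not only from a representative (\<open>connecting_eq\<close>), and the
  statements about the sequence become statements about lifts.

  The cycle \<open>\<kappa>(a)\<close> bounds in \<open>B\<close> exactly when some pair satisfies \<open>lift n q p a \<zero>\<close>, that is, when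
  the class of \<open>a\<close> is a value of the connecting homomorphism; this is exactness at \<open>H(A)\<close>. If
  \<open>\<kappa>(a\<^sub>1)\<close> and \<open>\<kappa>(a\<^sub>2)\<close> are homologous, then \<open>lift n q p a\<^sub>2 a\<^sub>1\<close> for some pair, and comparing it
  with a representative over the same cycle of \<open>G\<close> gives normality. For exactness at \<open>H(B)\<close> one
  uses a representative \<open>r\<close> over the chain of \<open>G\<close> that bounds \<open>\<sigma>(b)\<close>: since \<open>\<partial>\<^sup>-\<close> sends \<open>r\<close> to a
  representative, \<open>b + \<partial>\<^sup>+r = \<kappa>(a) + \<partial>\<^sup>-r\<close> for some \<open>a\<close>.

  Finally, the kernel of the connecting homomorphism consists of the classes under pairs with
  \<open>lift n q p \<zero> \<zero>\<close>, and these pairs are precisely the cycles of \<open>K(B)\<close>. Hence under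
  the embedding of \<open>H(G)\<close> into \<open>H(K(G))\<close> the kernel becomes the image of \<open>H(K(B))\<close>
  (\<open>image_kernel_connecting\<close>), so exactness at \<open>H(G)\<close> amounts to the equality of two images.
\<close>

section \<open>Homomorphisms and cancellation\<close>

lemma cancellativeD:
  assumes "cancellative M" "a \<in> carrier M" "x \<in> carrier M" "y \<in> carrier M"
    and "a \<oplus>\<^bsub>M\<^esub> x = a \<oplus>\<^bsub>M\<^esub> y"
  shows "x = y"
  using assms unfolding cancellative_def by blast

lemma abelian_group_cancellative:
  assumes "abelian_group M"
  shows "cancellative M"
proof -
  interpret abelian_group M by fact
  show ?thesis unfolding cancellative_def using add.Units_l_cancel add.Units_eq by simp
qed

lemma semimodule_homD:
  assumes "f \<in> semimodule_hom R M N"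
  shows "x \<in> carrier M \<Longrightarrow> f x \<in> carrier N"
    and "x \<in> carrier M \<Longrightarrow> y \<in> carrier M \<Longrightarrow> f (x \<oplus>\<^bsub>M\<^esub> y) = f x \<oplus>\<^bsub>N\<^esub> f y"
    and "r \<in> carrier R \<Longrightarrow> x \<in> carrier M \<Longrightarrow> f (r \<odot>\<^bsub>M\<^esub> x) = r \<odot>\<^bsub>N\<^esub> f x"
  using assms unfolding semimodule_hom_def by auto

lemma (in semimodule) smult_r_null [simp]:
  assumes "r \<in> carrier R"
  shows "r \<odot>\<^bsub>M\<^esub> \<zero>\<^bsub>M\<^esub> = \<zero>\<^bsub>M\<^esub>"
proof -
  have "r \<odot>\<^bsub>M\<^esub> (\<zero>\<^bsub>R\<^esub> \<odot>\<^bsub>M\<^esub> \<zero>\<^bsub>M\<^esub>) = (r \<otimes>\<^bsub>R\<^esub> \<zero>\<^bsub>R\<^esub>) \<odot>\<^bsub>M\<^esub> \<zero>\<^bsub>M\<^esub>"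
    using assms by (intro smult_assoc1[symmetric]) auto
  then show ?thesis using assms by simp
qed

section \<open>Homology classes\<close>

locale semi_chain_complex =
  fixes R :: "('r, 'm) ring_scheme" and X :: "('r, 'a) semi_complex"
  assumes complex: "chain_complex R X"
begin

sublocale deg: semimodule R "obj X n" for n
  by (rule semimodule_obj[OF complex])

lemma d_closed [simp]:
  "x \<in> carrier (obj X n) \<Longrightarrow> dplus X n x \<in> carrier (obj X (n - 1))"
  "x \<in> carrier (obj X n) \<Longrightarrow> dminus X n x \<in> carrier (obj X (n - 1))"
  "y \<in> carrier (obj X (n + 1)) \<Longrightarrow> dplus X (n + 1) y \<in> carrier (obj X n)"
  "y \<in> carrier (obj X (n + 1)) \<Longrightarrow> dminus X (n + 1) y \<in> carrier (obj X n)"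
  using differential_hom[OF complex, THEN semimodule_homD(1)]
    differential_hom_Suc[OF complex, THEN semimodule_homD(1)] by blast+

lemma d_add [simp]:
  assumes "x \<in> carrier (obj X n)" "y \<in> carrier (obj X n)"
  shows "dplus X n (x \<oplus>\<^bsub>obj X n\<^esub> y) = dplus X n x \<oplus>\<^bsub>obj X (n - 1)\<^esub> dplus X n y"
    and "dminus X n (x \<oplus>\<^bsub>obj X n\<^esub> y) = dminus X n x \<oplus>\<^bsub>obj X (n - 1)\<^esub> dminus X n y"
  using differential_hom[OF complex] assms by (auto dest: semimodule_homD)

lemma d_smult [simp]:
  assumes "r \<in> carrier R" "x \<in> carrier (obj X n)"
  shows "dplus X n (r \<odot>\<^bsub>obj X n\<^esub> x) = r \<odot>\<^bsub>obj X (n - 1)\<^esub> dplus X n x"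
    and "dminus X n (r \<odot>\<^bsub>obj X n\<^esub> x) = r \<odot>\<^bsub>obj X (n - 1)\<^esub> dminus X n x"
  using differential_hom[OF complex] assms by (auto dest: semimodule_homD)

lemma d_zero [simp]:
  "dplus X n \<zero>\<^bsub>obj X n\<^esub> = \<zero>\<^bsub>obj X (n - 1)\<^esub>"
  "dminus X n \<zero>\<^bsub>obj X n\<^esub> = \<zero>\<^bsub>obj X (n - 1)\<^esub>"
  using semimodule_hom_zero[OF deg.semimodule_axioms deg.semimodule_axioms] differential_hom[OF complex]
  by blast+

lemma d_d:
  assumes "x \<in> carrier (obj X (n + 1))"
  shows "dplus X n (dplus X (n + 1) x) \<oplus>\<^bsub>obj X (n - 1)\<^esub> dminus X n (dminus X (n + 1) x)
       = dplus X n (dminus X (n + 1) x) \<oplus>\<^bsub>obj X (n - 1)\<^esub> dminus X n (dplus X (n + 1) x)"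
  using complex assms unfolding chain_complex_def by blast

lemma cyclesD: "x \<in> cycles X n \<Longrightarrow> x \<in> carrier (obj X n)"
  "x \<in> cycles X n \<Longrightarrow> dplus X n x = dminus X n x"
  by (auto simp: cycles_def)

lemma cycles_closed:
  "\<zero>\<^bsub>obj X n\<^esub> \<in> cycles X n"
  "x \<in> cycles X n \<Longrightarrow> y \<in> cycles X n \<Longrightarrow> x \<oplus>\<^bsub>obj X n\<^esub> y \<in> cycles X n"
  "r \<in> carrier R \<Longrightarrow> x \<in> cycles X n \<Longrightarrow> r \<odot>\<^bsub>obj X n\<^esub> x \<in> cycles X n"
  by (auto simp: cycles_def)

lemma homologousI:
  assumes "x \<in> cycles X n" "y \<in> cycles X n" "u \<in> carrier (obj X (n + 1))" "v \<in> carrier (obj X (n + 1))"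
    and "x \<oplus>\<^bsub>obj X n\<^esub> dplus X (n + 1) u \<oplus>\<^bsub>obj X n\<^esub> dminus X (n + 1) v
       = y \<oplus>\<^bsub>obj X n\<^esub> dplus X (n + 1) v \<oplus>\<^bsub>obj X n\<^esub> dminus X (n + 1) u"
  shows "(x, y) \<in> homologous X n"
  using assms unfolding homologous_def by blast

lemma homologousE:
  assumes "(x, y) \<in> homologous X n"
  obtains u v where "x \<in> cycles X n" "y \<in> cycles X n"
    "u \<in> carrier (obj X (n + 1))" "v \<in> carrier (obj X (n + 1))"
    "x \<oplus>\<^bsub>obj X n\<^esub> dplus X (n + 1) u \<oplus>\<^bsub>obj X n\<^esub> dminus X (n + 1) v
       = y \<oplus>\<^bsub>obj X n\<^esub> dplus X (n + 1) v \<oplus>\<^bsub>obj X n\<^esub> dminus X (n + 1) u"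
  using assms unfolding homologous_def by blast

text \<open>
  Homology is only a relation between cycles; this lemma supplies the missing cycle condition. It is
  how elements of \<open>A\<close> that arise from a chase are recognised as cycles.
\<close>
lemma cycle_if_homologous:
  assumes canc: "\<And>n. cancellative (obj X n)" and x: "x \<in> cycles X n" and y: "y \<in> carrier (obj X n)"
    and u: "u \<in> carrier (obj X (n + 1))" "v \<in> carrier (obj X (n + 1))"
    and e: "x \<oplus>\<^bsub>obj X n\<^esub> dplus X (n + 1) u \<oplus>\<^bsub>obj X n\<^esub> dminus X (n + 1) v
       = y \<oplus>\<^bsub>obj X n\<^esub> dplus X (n + 1) v \<oplus>\<^bsub>obj X n\<^esub> dminus X (n + 1) u"
  shows "y \<in> cycles X n"
proof -
  let ?M = "obj X (n - 1)"
  let ?pu = "dplus X (n + 1) u" let ?mu = "dminus X (n + 1) u"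
  let ?pv = "dplus X (n + 1) v" let ?mv = "dminus X (n + 1) v"
  note c = y u cyclesD(1)[OF x]
  \<comment> \<open>Added to \<open>\<partial>\<^sup>+y\<close>, it completes the image of the equation under \<open>\<partial>\<^sup>+\<close> and, at the same time, the
    reversed image under \<open>\<partial>\<^sup>-\<close>.\<close>
  let ?z = "dplus X n x \<oplus>\<^bsub>?M\<^esub> (dplus X n ?pv \<oplus>\<^bsub>?M\<^esub> dminus X n ?mv)
      \<oplus>\<^bsub>?M\<^esub> (dplus X n ?mu \<oplus>\<^bsub>?M\<^esub> dminus X n ?pu)"
  have p: "dplus X n x \<oplus>\<^bsub>?M\<^esub> dplus X n ?pu \<oplus>\<^bsub>?M\<^esub> dplus X n ?mv
     = dplus X n y \<oplus>\<^bsub>?M\<^esub> dplus X n ?pv \<oplus>\<^bsub>?M\<^esub> dplus X n ?mu"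
    using arg_cong[OF e, of "dplus X n"] c by simp
  have m: "dplus X n x \<oplus>\<^bsub>?M\<^esub> dminus X n ?pu \<oplus>\<^bsub>?M\<^esub> dminus X n ?mv
     = dminus X n y \<oplus>\<^bsub>?M\<^esub> dminus X n ?pv \<oplus>\<^bsub>?M\<^esub> dminus X n ?mu"
    using arg_cong[OF e, of "dminus X n"] c cyclesD(2)[OF x] by simp
  have "?z \<oplus>\<^bsub>?M\<^esub> dplus X n y
      = (dplus X n y \<oplus>\<^bsub>?M\<^esub> dplus X n ?pv \<oplus>\<^bsub>?M\<^esub> dplus X n ?mu) \<oplus>\<^bsub>?M\<^esub>
        (dplus X n x \<oplus>\<^bsub>?M\<^esub> dminus X n ?pu \<oplus>\<^bsub>?M\<^esub> dminus X n ?mv)"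
    using c by (simp add: deg.M.a_ac)
  also have "\<dots> = (dplus X n x \<oplus>\<^bsub>?M\<^esub> dplus X n ?pu \<oplus>\<^bsub>?M\<^esub> dplus X n ?mv) \<oplus>\<^bsub>?M\<^esub>
        (dminus X n y \<oplus>\<^bsub>?M\<^esub> dminus X n ?pv \<oplus>\<^bsub>?M\<^esub> dminus X n ?mu)"
    unfolding p m ..
  also have "\<dots> = dplus X n x \<oplus>\<^bsub>?M\<^esub> (dplus X n ?pu \<oplus>\<^bsub>?M\<^esub> dminus X n ?mu) \<oplus>\<^bsub>?M\<^esub>
        (dplus X n ?mv \<oplus>\<^bsub>?M\<^esub> dminus X n ?pv) \<oplus>\<^bsub>?M\<^esub> dminus X n y"
    using c by (simp add: deg.M.a_ac)
  also have "\<dots> = ?z \<oplus>\<^bsub>?M\<^esub> dminus X n y"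
    unfolding d_d[OF u(1)] d_d[OF u(2)] using c by (simp add: deg.M.a_ac)
  finally have "?z \<oplus>\<^bsub>?M\<^esub> dplus X n y = ?z \<oplus>\<^bsub>?M\<^esub> dminus X n y" .
  then have "dplus X n y = dminus X n y"
    by (rule cancellativeD[OF canc, rotated -1]) (use c in simp_all)
  then show ?thesis using y by (simp add: cycles_def)
qed

lemma homologous_refl: "x \<in> cycles X n \<Longrightarrow> (x, x) \<in> homologous X n"
  using equiv_homologous[OF complex] by (meson equivE refl_onD)

lemma homologous_add:
  assumes "(x, y) \<in> homologous X n" "(x', y') \<in> homologous X n"
  shows "(x \<oplus>\<^bsub>obj X n\<^esub> x', y \<oplus>\<^bsub>obj X n\<^esub> y') \<in> homologous X n"
proof -
  obtain u v where u: "x \<in> cycles X n" "y \<in> cycles X n"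
    "u \<in> carrier (obj X (n + 1))" "v \<in> carrier (obj X (n + 1))"
    and e: "x \<oplus>\<^bsub>obj X n\<^esub> dplus X (n + 1) u \<oplus>\<^bsub>obj X n\<^esub> dminus X (n + 1) v
       = y \<oplus>\<^bsub>obj X n\<^esub> dplus X (n + 1) v \<oplus>\<^bsub>obj X n\<^esub> dminus X (n + 1) u"
    using assms(1) by (rule homologousE)
  obtain u' v' where u': "x' \<in> cycles X n" "y' \<in> cycles X n"
    "u' \<in> carrier (obj X (n + 1))" "v' \<in> carrier (obj X (n + 1))"
    and e': "x' \<oplus>\<^bsub>obj X n\<^esub> dplus X (n + 1) u' \<oplus>\<^bsub>obj X n\<^esub> dminus X (n + 1) v'
       = y' \<oplus>\<^bsub>obj X n\<^esub> dplus X (n + 1) v' \<oplus>\<^bsub>obj X n\<^esub> dminus X (n + 1) u'"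
    using assms(2) by (rule homologousE)
  note c = u(3,4) u'(3,4) u(1,2)[THEN cyclesD(1)] u'(1,2)[THEN cyclesD(1)]
  show ?thesis
  proof (rule homologousI[of _ _ _ "u \<oplus>\<^bsub>obj X (n + 1)\<^esub> u'" "v \<oplus>\<^bsub>obj X (n + 1)\<^esub> v'"])
    have "(x \<oplus>\<^bsub>obj X n\<^esub> x') \<oplus>\<^bsub>obj X n\<^esub> dplus X (n + 1) (u \<oplus>\<^bsub>obj X (n + 1)\<^esub> u')
           \<oplus>\<^bsub>obj X n\<^esub> dminus X (n + 1) (v \<oplus>\<^bsub>obj X (n + 1)\<^esub> v')
        = (x \<oplus>\<^bsub>obj X n\<^esub> dplus X (n + 1) u \<oplus>\<^bsub>obj X n\<^esub> dminus X (n + 1) v) \<oplus>\<^bsub>obj X n\<^esub>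
          (x' \<oplus>\<^bsub>obj X n\<^esub> dplus X (n + 1) u' \<oplus>\<^bsub>obj X n\<^esub> dminus X (n + 1) v')"
      using c by (simp add: deg.M.a_ac)
    also have "\<dots> = (y \<oplus>\<^bsub>obj X n\<^esub> y') \<oplus>\<^bsub>obj X n\<^esub> dplus X (n + 1) (v \<oplus>\<^bsub>obj X (n + 1)\<^esub> v')
           \<oplus>\<^bsub>obj X n\<^esub> dminus X (n + 1) (u \<oplus>\<^bsub>obj X (n + 1)\<^esub> u')"
      unfolding e e' using c by (simp add: deg.M.a_ac)
    finally show "(x \<oplus>\<^bsub>obj X n\<^esub> x') \<oplus>\<^bsub>obj X n\<^esub> dplus X (n + 1) (u \<oplus>\<^bsub>obj X (n + 1)\<^esub> u')
           \<oplus>\<^bsub>obj X n\<^esub> dminus X (n + 1) (v \<oplus>\<^bsub>obj X (n + 1)\<^esub> v')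
        = (y \<oplus>\<^bsub>obj X n\<^esub> y') \<oplus>\<^bsub>obj X n\<^esub> dplus X (n + 1) (v \<oplus>\<^bsub>obj X (n + 1)\<^esub> v')
           \<oplus>\<^bsub>obj X n\<^esub> dminus X (n + 1) (u \<oplus>\<^bsub>obj X (n + 1)\<^esub> u')" .
  qed (use u u' in \<open>auto intro: cycles_closed\<close>)
qed

lemma homologous_smult:
  assumes "r \<in> carrier R" "(x, y) \<in> homologous X n"
  shows "(r \<odot>\<^bsub>obj X n\<^esub> x, r \<odot>\<^bsub>obj X n\<^esub> y) \<in> homologous X n"
proof -
  obtain u v where u: "x \<in> cycles X n" "y \<in> cycles X n"
    "u \<in> carrier (obj X (n + 1))" "v \<in> carrier (obj X (n + 1))"
    and e: "x \<oplus>\<^bsub>obj X n\<^esub> dplus X (n + 1) u \<oplus>\<^bsub>obj X n\<^esub> dminus X (n + 1) v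
       = y \<oplus>\<^bsub>obj X n\<^esub> dplus X (n + 1) v \<oplus>\<^bsub>obj X n\<^esub> dminus X (n + 1) u"
    using assms(2) by (rule homologousE)
  note c = u(3,4) u(1,2)[THEN cyclesD(1)]
  have "(r \<odot>\<^bsub>obj X n\<^esub> x) \<oplus>\<^bsub>obj X n\<^esub> dplus X (n + 1) (r \<odot>\<^bsub>obj X (n + 1)\<^esub> u)
          \<oplus>\<^bsub>obj X n\<^esub> dminus X (n + 1) (r \<odot>\<^bsub>obj X (n + 1)\<^esub> v)
      = (r \<odot>\<^bsub>obj X n\<^esub> y) \<oplus>\<^bsub>obj X n\<^esub> dplus X (n + 1) (r \<odot>\<^bsub>obj X (n + 1)\<^esub> v)
          \<oplus>\<^bsub>obj X n\<^esub> dminus X (n + 1) (r \<odot>\<^bsub>obj X (n + 1)\<^esub> u)"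
    using arg_cong[OF e, of "\<lambda>z. r \<odot>\<^bsub>obj X n\<^esub> z"] c assms(1) by (simp add: deg.smult_r_distr)
  then show ?thesis using u assms(1) 
    by (intro homologousI[of _ _ _ "r \<odot>\<^bsub>obj X (n + 1)\<^esub> u" "r \<odot>\<^bsub>obj X (n + 1)\<^esub> v"])
      (auto intro: cycles_closed)
qed

lemma hcl_eq_iff:
  assumes "x \<in> cycles X n" "y \<in> cycles X n"
  shows "hcl X n x = hcl X n y \<longleftrightarrow> (x, y) \<in> homologous X n"
  unfolding hcl_def using assms by (rule eq_equiv_class_iff[OF equiv_homologous[OF complex]])

lemma mem_hcl_iff: "y \<in> hcl X n x \<longleftrightarrow> (x, y) \<in> homologous X n"
  by (simp add: hcl_def)

lemma homology_carrier: "carrier (homology X n) = hcl X n ` cycles X n"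
  by (auto simp: homology_def quotient_def hcl_def)

lemma homology_zero: "\<zero>\<^bsub>homology X n\<^esub> = hcl X n \<zero>\<^bsub>obj X n\<^esub>"
  by (simp add: homology_def)

lemma homology_add:
  assumes "x \<in> cycles X n" "y \<in> cycles X n"
  shows "hcl X n x \<oplus>\<^bsub>homology X n\<^esub> hcl X n y = hcl X n (x \<oplus>\<^bsub>obj X n\<^esub> y)"
proof -
  have "congruent2 (homologous X n) (homologous X n) (\<lambda>x y. hcl X n (x \<oplus>\<^bsub>obj X n\<^esub> y))"
    unfolding hcl_def by (intro congruent2I' equiv_class_eq[OF equiv_homologous[OF complex]] homologous_add)
  from UN_equiv_class2[OF equiv_homologous[OF complex] equiv_homologous[OF complex] this assms]
  show ?thesis by (simp add: homology_def hcl_def)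
qed

lemma homology_smult:
  assumes "r \<in> carrier R" "x \<in> cycles X n"
  shows "r \<odot>\<^bsub>homology X n\<^esub> hcl X n x = hcl X n (r \<odot>\<^bsub>obj X n\<^esub> x)"
proof -
  have "congruent (homologous X n) (\<lambda>x. hcl X n (r \<odot>\<^bsub>obj X n\<^esub> x))"
    unfolding hcl_def using assms(1)
    by (intro congruentI equiv_class_eq[OF equiv_homologous[OF complex]] homologous_smult)
  from UN_equiv_class[OF equiv_homologous[OF complex] this assms(2)]
  show ?thesis by (simp add: homology_def hcl_def)
qed

end

text \<open>
  The two complexes may have different scalars because the map from a complex to its completion
  is to be an instance.
\<close>

locale complex_map =
  X: semi_chain_complex R X + Y: semi_chain_complex S Y
  for R :: "('r, 'm) ring_scheme" and X :: "('r, 'a) semi_complex"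
    and S :: "('s, 'k) ring_scheme" and Y :: "('s, 'b) semi_complex" +
  fixes f :: "int \<Rightarrow> 'a \<Rightarrow> 'b"
  assumes map_closed [simp]: "x \<in> carrier (obj X n) \<Longrightarrow> f n x \<in> carrier (obj Y n)"
    and map_add [simp]: "x \<in> carrier (obj X n) \<Longrightarrow> y \<in> carrier (obj X n) \<Longrightarrow>
      f n (x \<oplus>\<^bsub>obj X n\<^esub> y) = f n x \<oplus>\<^bsub>obj Y n\<^esub> f n y"
    and map_d: "x \<in> carrier (obj X n) \<Longrightarrow>
      dplus Y n (f n x) \<oplus>\<^bsub>obj Y (n - 1)\<^esub> f (n - 1) (dminus X n x)
        = dminus Y n (f n x) \<oplus>\<^bsub>obj Y (n - 1)\<^esub> f (n - 1) (dplus X n x)"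
    and target_cancellative: "cancellative (obj Y n)"
begin

text \<open>
  A morphism need not commute with \<open>\<partial>\<^sup>+\<close> and \<open>\<partial>\<^sup>-\<close> separately, only with their difference. Hence an
  equation between boundaries can be moved across \<open>f\<close> when \<open>\<partial>\<^sup>+\<close> of one chain is accompanied by
  \<open>\<partial>\<^sup>-\<close> of the same chain on the other side; cancellation in the target removes the error terms.
  Both directions matter: for injective \<open>f\<close> homology relations are also reflected.
\<close>
lemma map_d_pair:
  assumes a: "x \<in> carrier (obj X (n - 1))" "y \<in> carrier (obj X (n - 1))"
    and u: "u \<in> carrier (obj X n)" "v \<in> carrier (obj X n)"
  shows "f (n - 1) x \<oplus>\<^bsub>obj Y (n - 1)\<^esub> dplus Y n (f n u) \<oplus>\<^bsub>obj Y (n - 1)\<^esub> dminus Y n (f n v)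
       = f (n - 1) y \<oplus>\<^bsub>obj Y (n - 1)\<^esub> dplus Y n (f n v) \<oplus>\<^bsub>obj Y (n - 1)\<^esub> dminus Y n (f n u)
     \<longleftrightarrow> f (n - 1) (x \<oplus>\<^bsub>obj X (n - 1)\<^esub> dplus X n u \<oplus>\<^bsub>obj X (n - 1)\<^esub> dminus X n v)
       = f (n - 1) (y \<oplus>\<^bsub>obj X (n - 1)\<^esub> dplus X n v \<oplus>\<^bsub>obj X (n - 1)\<^esub> dminus X n u)"
    (is "?l = ?r \<longleftrightarrow> ?l' = ?r'")
proof -
  let ?M = "obj Y (n - 1)"
  \<comment> \<open>Adding \<open>?s\<close> makes \<open>map_d\<close> applicable to \<open>u\<close> on the left and to \<open>v\<close> on the right; both
    applications leave behind the same summand \<open>?t\<close>.\<close>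
  let ?s = "f (n - 1) (dminus X n u) \<oplus>\<^bsub>?M\<^esub> f (n - 1) (dminus X n v)"
  let ?t = "dminus Y n (f n u) \<oplus>\<^bsub>?M\<^esub> dminus Y n (f n v)"
  have c: "?l \<in> carrier ?M" "?r \<in> carrier ?M" "?l' \<in> carrier ?M" "?r' \<in> carrier ?M"
    "?s \<in> carrier ?M" "?t \<in> carrier ?M" using a u by simp_all
  have "?s \<oplus>\<^bsub>?M\<^esub> ?l = f (n - 1) x \<oplus>\<^bsub>?M\<^esub> (dplus Y n (f n u) \<oplus>\<^bsub>?M\<^esub> f (n - 1) (dminus X n u))
      \<oplus>\<^bsub>?M\<^esub> dminus Y n (f n v) \<oplus>\<^bsub>?M\<^esub> f (n - 1) (dminus X n v)"
    using a u by (simp add: Y.deg.M.a_ac)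
  also have "\<dots> = ?t \<oplus>\<^bsub>?M\<^esub> ?l'"
    unfolding map_d[OF u(1)] using a u by (simp add: Y.deg.M.a_ac)
  finally have 1: "?s \<oplus>\<^bsub>?M\<^esub> ?l = ?t \<oplus>\<^bsub>?M\<^esub> ?l'" .
  have "?s \<oplus>\<^bsub>?M\<^esub> ?r = f (n - 1) y \<oplus>\<^bsub>?M\<^esub> (dplus Y n (f n v) \<oplus>\<^bsub>?M\<^esub> f (n - 1) (dminus X n v))
      \<oplus>\<^bsub>?M\<^esub> dminus Y n (f n u) \<oplus>\<^bsub>?M\<^esub> f (n - 1) (dminus X n u)"
    using a u by (simp add: Y.deg.M.a_ac)
  also have "\<dots> = ?t \<oplus>\<^bsub>?M\<^esub> ?r'"
    unfolding map_d[OF u(2)] using a u by (simp add: Y.deg.M.a_ac)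
  finally have 2: "?s \<oplus>\<^bsub>?M\<^esub> ?r = ?t \<oplus>\<^bsub>?M\<^esub> ?r'" .
  show ?thesis
  proof
    assume "?l = ?r"
    with 1 2 have "?t \<oplus>\<^bsub>?M\<^esub> ?l' = ?t \<oplus>\<^bsub>?M\<^esub> ?r'" by simp
    then show "?l' = ?r'" by (rule cancellativeD[OF target_cancellative c(6,3,4)])
  next
    assume "?l' = ?r'"
    with 1 2 have "?s \<oplus>\<^bsub>?M\<^esub> ?l = ?s \<oplus>\<^bsub>?M\<^esub> ?r" by simp
    then show "?l = ?r" by (rule cancellativeD[OF target_cancellative c(5,1,2)])
  qed
qed

lemma map_d_eq_iff:
  assumes "x \<in> carrier (obj X n)"
  shows "dplus Y n (f n x) = dminus Y n (f n x) \<longleftrightarrow>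
    f (n - 1) (dplus X n x) = f (n - 1) (dminus X n x)"
proof -
  let ?M = "obj Y (n - 1)"
  have c: "f (n - 1) (dplus X n x) \<in> carrier ?M" "f (n - 1) (dminus X n x) \<in> carrier ?M"
    "dplus Y n (f n x) \<in> carrier ?M" "dminus Y n (f n x) \<in> carrier ?M" using assms by simp_all
  show ?thesis
  proof
    assume "dplus Y n (f n x) = dminus Y n (f n x)"
    then have "dminus Y n (f n x) \<oplus>\<^bsub>?M\<^esub> f (n - 1) (dplus X n x)
       = dminus Y n (f n x) \<oplus>\<^bsub>?M\<^esub> f (n - 1) (dminus X n x)"
      using map_d[OF assms] by simp
    then show "f (n - 1) (dplus X n x) = f (n - 1) (dminus X n x)"
      by (rule cancellativeD[OF target_cancellative c(4,1,2)])
  next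
    assume "f (n - 1) (dplus X n x) = f (n - 1) (dminus X n x)"
    then have "f (n - 1) (dminus X n x) \<oplus>\<^bsub>?M\<^esub> dplus Y n (f n x)
       = f (n - 1) (dminus X n x) \<oplus>\<^bsub>?M\<^esub> dminus Y n (f n x)"
      using map_d[OF assms] assms by (simp add: Y.deg.M.a_comm)
    then show "dplus Y n (f n x) = dminus Y n (f n x)"
      by (rule cancellativeD[OF target_cancellative c(2,3,4)])
  qed
qed

lemma map_cycle: "x \<in> cycles X n \<Longrightarrow> f n x \<in> cycles Y n"
  using map_d_eq_iff[of x n] by (simp add: cycles_def)

lemma map_homologous:
  assumes "(x, y) \<in> homologous X n"
  shows "(f n x, f n y) \<in> homologous Y n"
proof -
  obtain u v where u: "x \<in> cycles X n" "y \<in> cycles X n"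
    "u \<in> carrier (obj X (n + 1))" "v \<in> carrier (obj X (n + 1))"
    "x \<oplus>\<^bsub>obj X n\<^esub> dplus X (n + 1) u \<oplus>\<^bsub>obj X n\<^esub> dminus X (n + 1) v
       = y \<oplus>\<^bsub>obj X n\<^esub> dplus X (n + 1) v \<oplus>\<^bsub>obj X n\<^esub> dminus X (n + 1) u"
    using assms by (rule X.homologousE)
  have "f n x \<oplus>\<^bsub>obj Y n\<^esub> dplus Y (n + 1) (f (n + 1) u) \<oplus>\<^bsub>obj Y n\<^esub> dminus Y (n + 1) (f (n + 1) v)
       = f n y \<oplus>\<^bsub>obj Y n\<^esub> dplus Y (n + 1) (f (n + 1) v) \<oplus>\<^bsub>obj Y n\<^esub> dminus Y (n + 1) (f (n + 1) u)"
    using map_d_pair[of x "n + 1" y u v] u X.cyclesD(1) by simp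
  with u show ?thesis by (intro Y.homologousI[OF map_cycle map_cycle]) simp_all
qed

lemma homology_map_class:
  assumes "x \<in> cycles X n"
  shows "homology_map Y n f (hcl X n x) = hcl Y n (f n x)"
  by (rule homology_map_hcl[where f = f, OF X.complex Y.complex map_homologous assms])

end

lemma homology_map_semimodule_hom:
  assumes "chain_complex R X" "chain_complex R Y" "chain_morphism R X Y f" "\<And>n. cancellative (obj Y n)"
  shows "complex_map R X R Y f"
    and "homology_map Y n f \<in> semimodule_hom R (homology X n) (homology Y n)"
proof -
  have h: "f n \<in> semimodule_hom R (obj X n) (obj Y n)" for n
    using assms(3) by (simp add: chain_morphism_def)
  show "complex_map R X R Y f"
    using assms semimodule_homD(1,2)[OF h] by unfold_locales (auto simp: chain_morphism_def)
  then interpret complex_map R X R Y f .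
  show "homology_map Y n f \<in> semimodule_hom R (homology X n) (homology Y n)"
    unfolding semimodule_hom_def
  proof (intro CollectI conjI ballI)
    show "homology_map Y n f \<in> carrier (homology X n) \<rightarrow> carrier (homology Y n)"
      by (auto simp: X.homology_carrier Y.homology_carrier homology_map_class map_cycle)
  next
    fix c c' assume "c \<in> carrier (homology X n)" "c' \<in> carrier (homology X n)"
    then obtain x y where c: "x \<in> cycles X n" "c = hcl X n x" "y \<in> cycles X n" "c' = hcl X n y"
      by (auto simp: X.homology_carrier)
    then show "homology_map Y n f (c \<oplus>\<^bsub>homology X n\<^esub> c')
        = homology_map Y n f c \<oplus>\<^bsub>homology Y n\<^esub> homology_map Y n f c'"
      by (simp add: X.homology_add Y.homology_add X.cycles_closed homology_map_class map_cycle X.cyclesD(1))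
  next
    fix r c assume "r \<in> carrier R" "c \<in> carrier (homology X n)"
    then obtain x where c: "x \<in> cycles X n" "c = hcl X n x" and r: "r \<in> carrier R"
      by (auto simp: X.homology_carrier)
    then show "homology_map Y n f (r \<odot>\<^bsub>homology X n\<^esub> c) = r \<odot>\<^bsub>homology Y n\<^esub> homology_map Y n f c"
      by (simp add: X.homology_smult Y.homology_smult X.cycles_closed homology_map_class map_cycle
          X.cyclesD(1) semimodule_homD(3)[OF h])
  qed
qed

section \<open>Completion\<close>

lemma (in abelian_monoid) K_cl_eq_iff:
  assumes "a \<in> carrier G" "b \<in> carrier G" "c \<in> carrier G" "d \<in> carrier G"
  shows "K_cl G a b = K_cl G c d \<longleftrightarrow> (\<exists>z\<in>carrier G. a \<oplus> d \<oplus> z = b \<oplus> c \<oplus> z)"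
  unfolding K_cl_def using eq_equiv_class_iff[OF equiv_K_rel, of "(a, b)" "(c, d)"] assms
  by (simp add: K_rel_iff)

text \<open>
  This is \<open>semimodule\<close> with \<open>M\<close> restricted to the plain record type on which the completion acts.
\<close>
locale completed_semimodule = semimodule R M
  for R :: "('r, 'm) ring_scheme" and M :: "('r, 'a) module"
begin

lemma cancellative_K_cl_eq_iff:
  assumes "cancellative M" "a \<in> carrier M" "b \<in> carrier M" "c \<in> carrier M" "d \<in> carrier M"
  shows "K_cl M a b = K_cl M c d \<longleftrightarrow> a \<oplus>\<^bsub>M\<^esub> d = b \<oplus>\<^bsub>M\<^esub> c"
proof
  assume "K_cl M a b = K_cl M c d"
  then obtain z where z: "z \<in> carrier M" "a \<oplus>\<^bsub>M\<^esub> d \<oplus>\<^bsub>M\<^esub> z = b \<oplus>\<^bsub>M\<^esub> c \<oplus>\<^bsub>M\<^esub> z"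
    using M.K_cl_eq_iff assms by auto
  have "z \<oplus>\<^bsub>M\<^esub> (a \<oplus>\<^bsub>M\<^esub> d) = z \<oplus>\<^bsub>M\<^esub> (b \<oplus>\<^bsub>M\<^esub> c)"
    using z assms by (simp add: M.a_comm)
  then show "a \<oplus>\<^bsub>M\<^esub> d = b \<oplus>\<^bsub>M\<^esub> c"
    by (rule cancellativeD[OF assms(1), rotated -1]) (use z assms in simp_all)
qed (use assms M.K_cl_eqI in blast)

lemma K_carrierE:
  assumes "c \<in> carrier (K_module M)"
  obtains a b where "a \<in> carrier M" "b \<in> carrier M" "c = K_cl M a b"
  using assms by (auto simp: K_module_def mem_K_carrier_iff)

lemma K_cl_closed [simp]:
  "a \<in> carrier M \<Longrightarrow> b \<in> carrier M \<Longrightarrow> K_cl M a b \<in> carrier (K_module M)"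
  by (auto simp: K_module_def mem_K_carrier_iff)

lemma K_module_add [simp]:
  assumes "a \<in> carrier M" "b \<in> carrier M" "c \<in> carrier M" "d \<in> carrier M"
  shows "K_cl M a b \<oplus>\<^bsub>K_module M\<^esub> K_cl M c d = K_cl M (a \<oplus>\<^bsub>M\<^esub> c) (b \<oplus>\<^bsub>M\<^esub> d)"
  using M.K_cl_add[OF assms] by (simp add: K_module_def)

lemma K_module_zero: "\<zero>\<^bsub>K_module M\<^esub> = K_cl M \<zero>\<^bsub>M\<^esub> \<zero>\<^bsub>M\<^esub>"
  by (simp add: K_module_def)

lemma K_module_smult:
  assumes "a1 \<in> carrier R" "a2 \<in> carrier R" "b1 \<in> carrier M" "b2 \<in> carrier M"
  shows "K_cl R a1 a2 \<odot>\<^bsub>K_module M\<^esub> K_cl M b1 b2 =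
    K_cl M (a1 \<odot>\<^bsub>M\<^esub> b1 \<oplus>\<^bsub>M\<^esub> a2 \<odot>\<^bsub>M\<^esub> b2) (a1 \<odot>\<^bsub>M\<^esub> b2 \<oplus>\<^bsub>M\<^esub> a2 \<odot>\<^bsub>M\<^esub> b1)"
  using K_cl_bilinear[OF R.abelian_monoid_axioms M.abelian_monoid_axioms M.abelian_monoid_axioms,
      where f = "smult M", OF smult_closed smult_l_distr smult_r_distr] assms
  by (simp add: K_module_def)

lemma K_module_semimodule: "semimodule (K_ring R) (K_module M)"
  by (rule semimodule_K_module[OF semimodule_axioms])

sublocale K: semimodule "K_ring R" "K_module M"
  by (rule K_module_semimodule)

lemma K_cl_neg:
  assumes "a \<in> carrier M" "b \<in> carrier M"
  shows "K_cl M b a \<oplus>\<^bsub>K_module M\<^esub> K_cl M a b = \<zero>\<^bsub>K_module M\<^esub>"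
  unfolding K_module_zero using assms by (simp add: M.a_comm, intro M.K_cl_eqI) simp_all

lemma K_module_group: "abelian_group (K_module M)"
proof (rule abelian_groupI)
  fix c assume "c \<in> carrier (K_module M)"
  then show "\<exists>y\<in>carrier (K_module M). y \<oplus>\<^bsub>K_module M\<^esub> c = \<zero>\<^bsub>K_module M\<^esub>"
    by (rule K_carrierE) (use K_cl_neg K_cl_closed in blast)
qed (simp_all add: K.M.a_ac)

lemma K_module_minus:
  assumes "a \<in> carrier M" "b \<in> carrier M" "c \<in> carrier M" "d \<in> carrier M"
  shows "K_cl M a b \<ominus>\<^bsub>K_module M\<^esub> K_cl M c d = K_cl M (a \<oplus>\<^bsub>M\<^esub> d) (b \<oplus>\<^bsub>M\<^esub> c)"
proof -
  interpret KG: abelian_group "K_module M" by (rule K_module_group)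
  have "\<ominus>\<^bsub>K_module M\<^esub> K_cl M c d = K_cl M d c"
    using KG.minus_equality[OF K_cl_neg] assms by simp
  then show ?thesis using assms by (simp add: KG.minus_eq)
qed

lemma K_map_K_cl:
  assumes N: "semimodule S N" and f: "f \<in> carrier M \<rightarrow> carrier N"
    "\<And>x y. x \<in> carrier M \<Longrightarrow> y \<in> carrier M \<Longrightarrow> f (x \<oplus>\<^bsub>M\<^esub> y) = f x \<oplus>\<^bsub>N\<^esub> f y"
    and a: "a \<in> carrier M" "b \<in> carrier M"
  shows "K_map N f (K_cl M a b) = K_cl N (f a) (f b)"
proof -
  interpret N: semimodule S N by fact
  have "congruent (K_rel M) (\<lambda>p. K_cl N (f (fst p)) (f (snd p)))"
  proof (rule congruentI, clarsimp simp: K_rel_iff)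
    fix u v x y z
    assume c: "u \<in> carrier M" "v \<in> carrier M" "x \<in> carrier M" "y \<in> carrier M" "z \<in> carrier M"
      and e: "u \<oplus>\<^bsub>M\<^esub> y \<oplus>\<^bsub>M\<^esub> z = v \<oplus>\<^bsub>M\<^esub> x \<oplus>\<^bsub>M\<^esub> z"
    have "f u \<oplus>\<^bsub>N\<^esub> f y \<oplus>\<^bsub>N\<^esub> f z = f v \<oplus>\<^bsub>N\<^esub> f x \<oplus>\<^bsub>N\<^esub> f z"
      using arg_cong[OF e, of f] c by (simp add: f(2))
    then show "K_cl N (f u) (f v) = K_cl N (f x) (f y)"
      using c f(1) by (subst N.M.K_cl_eq_iff) auto
  qed
  from UN_equiv_class[OF M.equiv_K_rel this, of "(a, b)"] a show ?thesis
    by (simp add: K_map_def K_cl_def case_prod_beta)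
qed

end

context semi_chain_complex
begin

sublocale compl: completed_semimodule R "obj X n" for n
  by unfold_locales

lemma K_complex_simps:
  "obj (K_complex X) n = K_module (obj X n)"
  "dminus (K_complex X) n c = \<zero>\<^bsub>K_module (obj X (n - 1))\<^esub>"
  by (simp_all add: K_complex_def complex_of_def)

lemma K_complex_dplus [simp]:
  assumes "a \<in> carrier (obj X n)" "b \<in> carrier (obj X n)"
  shows "dplus (K_complex X) n (K_cl (obj X n) a b) = K_cl (obj X (n - 1))
    (dplus X n a \<oplus>\<^bsub>obj X (n - 1)\<^esub> dminus X n b) (dplus X n b \<oplus>\<^bsub>obj X (n - 1)\<^esub> dminus X n a)"
proof -
  have "K_map (obj X (n - 1)) (dplus X n) (K_cl (obj X n) a b)
      = K_cl (obj X (n - 1)) (dplus X n a) (dplus X n b)"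
    by (rule compl.K_map_K_cl[OF deg.semimodule_axioms]) (use assms in auto)
  moreover have "K_map (obj X (n - 1)) (dminus X n) (K_cl (obj X n) a b)
      = K_cl (obj X (n - 1)) (dminus X n a) (dminus X n b)"
    by (rule compl.K_map_K_cl[OF deg.semimodule_axioms]) (use assms in auto)
  ultimately show ?thesis
    using assms by (simp add: K_complex_def complex_of_def compl.K_module_minus)
qed

lemma K_complex_dplus_hom:
  "dplus (K_complex X) n \<in> semimodule_hom (K_ring R) (K_module (obj X n)) (K_module (obj X (n - 1)))"
  unfolding semimodule_hom_def
proof (intro CollectI conjI ballI)
  show "dplus (K_complex X) n \<in> carrier (K_module (obj X n)) \<rightarrow> carrier (K_module (obj X (n - 1)))"
    by (auto elim!: compl.K_carrierE)
next
  fix x y assume "x \<in> carrier (K_module (obj X n))" "y \<in> carrier (K_module (obj X n))"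
  then show "dplus (K_complex X) n (x \<oplus>\<^bsub>K_module (obj X n)\<^esub> y)
     = dplus (K_complex X) n x \<oplus>\<^bsub>K_module (obj X (n - 1))\<^esub> dplus (K_complex X) n y"
    by (elim compl.K_carrierE) (simp add: deg.M.a_ac)
next
  fix r x assume "r \<in> carrier (K_ring R)" and x: "x \<in> carrier (K_module (obj X n))"
  then obtain r1 r2 where r: "r1 \<in> carrier R" "r2 \<in> carrier R" "r = K_cl R r1 r2"
    by (auto simp: K_ring_def mem_K_carrier_iff)
  obtain a b where "a \<in> carrier (obj X n)" "b \<in> carrier (obj X n)" "x = K_cl (obj X n) a b"
    using x by (rule compl.K_carrierE)
  with r show "dplus (K_complex X) n (r \<odot>\<^bsub>K_module (obj X n)\<^esub> x)
     = r \<odot>\<^bsub>K_module (obj X (n - 1))\<^esub> dplus (K_complex X) n x"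
    by (simp add: compl.K_module_smult deg.smult_r_distr deg.M.a_ac)
qed

lemma K_chain_complex: "chain_complex (K_ring R) (K_complex X)"
  unfolding chain_complex_def K_complex_simps(1)
proof (intro allI conjI ballI)
  fix n
  show "semimodule (K_ring R) (K_module (obj X n))" by (rule compl.K_module_semimodule)
  show "dplus (K_complex X) n \<in> semimodule_hom (K_ring R) (K_module (obj X n)) (K_module (obj X (n - 1)))"
    by (rule K_complex_dplus_hom)
  show "dminus (K_complex X) n \<in> semimodule_hom (K_ring R) (K_module (obj X n)) (K_module (obj X (n - 1)))"
    by (auto simp: semimodule_hom_def K_complex_simps)
  fix c assume "c \<in> carrier (K_module (obj X (n + 1)))"
  then obtain a b where c: "a \<in> carrier (obj X (n + 1))" "b \<in> carrier (obj X (n + 1))"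
    "c = K_cl (obj X (n + 1)) a b" by (rule compl.K_carrierE)
  have "dplus (K_complex X) (n + 1) c = K_cl (obj X n)
      (dplus X (n + 1) a \<oplus>\<^bsub>obj X n\<^esub> dminus X (n + 1) b) (dplus X (n + 1) b \<oplus>\<^bsub>obj X n\<^esub> dminus X (n + 1) a)"
    using K_complex_dplus[OF c(1,2)] c(3) by simp
  then have "dplus (K_complex X) n (dplus (K_complex X) (n + 1) c) = K_cl (obj X (n - 1))
      ((dplus X n (dplus X (n + 1) a) \<oplus>\<^bsub>obj X (n - 1)\<^esub> dminus X n (dminus X (n + 1) a)) \<oplus>\<^bsub>obj X (n - 1)\<^esub>
       (dplus X n (dminus X (n + 1) b) \<oplus>\<^bsub>obj X (n - 1)\<^esub> dminus X n (dplus X (n + 1) b)))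
      ((dplus X n (dplus X (n + 1) b) \<oplus>\<^bsub>obj X (n - 1)\<^esub> dminus X n (dminus X (n + 1) b)) \<oplus>\<^bsub>obj X (n - 1)\<^esub>
       (dplus X n (dminus X (n + 1) a) \<oplus>\<^bsub>obj X (n - 1)\<^esub> dminus X n (dplus X (n + 1) a)))"
    using c by (simp add: deg.M.a_ac)
  also have "\<dots> = \<zero>\<^bsub>K_module (obj X (n - 1))\<^esub>"
    unfolding d_d[OF c(1)] d_d[OF c(2)] compl.K_module_zero
    using c by (intro deg.M.K_cl_eqI) (simp_all add: deg.M.a_ac)
  finally have dd: "dplus (K_complex X) n (dplus (K_complex X) (n + 1) c) = \<zero>\<^bsub>K_module (obj X (n - 1))\<^esub>" .
  have "dplus (K_complex X) n \<zero>\<^bsub>K_module (obj X (n + 1 - 1))\<^esub> = \<zero>\<^bsub>K_module (obj X (n - 1))\<^esub>"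
    using semimodule_hom_zero[OF compl.K_module_semimodule compl.K_module_semimodule K_complex_dplus_hom[of n]] by simp
  then show "dplus (K_complex X) n (dplus (K_complex X) (n + 1) c) \<oplus>\<^bsub>K_module (obj X (n - 1))\<^esub>
        dminus (K_complex X) n (dminus (K_complex X) (n + 1) c)
    = dplus (K_complex X) n (dminus (K_complex X) (n + 1) c) \<oplus>\<^bsub>K_module (obj X (n - 1))\<^esub>
        dminus (K_complex X) n (dplus (K_complex X) (n + 1) c)"
    by (simp only: dd K_complex_simps(2))
qed

lemma K_semi_chain_complex: "semi_chain_complex (K_ring R) (K_complex X)"
  by (rule semi_chain_complex.intro) (rule K_chain_complex)

lemma K_complex_cancellative: "cancellative (obj (K_complex X) n)"
  unfolding K_complex_simps by (rule abelian_group_cancellative[OF compl.K_module_group])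

lemma K_cl_cycle_iff:
  assumes canc: "\<And>n. cancellative (obj X n)" and a: "a \<in> carrier (obj X n)" "b \<in> carrier (obj X n)"
  shows "K_cl (obj X n) a b \<in> cycles (K_complex X) n \<longleftrightarrow>
    dplus X n a \<oplus>\<^bsub>obj X (n - 1)\<^esub> dminus X n b = dplus X n b \<oplus>\<^bsub>obj X (n - 1)\<^esub> dminus X n a"
  using a compl.cancellative_K_cl_eq_iff[OF canc, of _ "n - 1"]
  by (simp add: cycles_def K_complex_simps compl.K_module_zero)

lemma K_unit_complex_map: "complex_map R X (K_ring R) (K_complex X) (\<lambda>n. K_unit (obj X n))"
proof (intro complex_map.intro complex_map_axioms.intro semi_chain_complex_axioms K_semi_chain_complex)
  fix n x y assume x: "x \<in> carrier (obj X n)"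
  show "K_unit (obj X n) x \<in> carrier (obj (K_complex X) n)"
    using x by (simp add: K_unit_def K_complex_simps)
  show "y \<in> carrier (obj X n) \<Longrightarrow> K_unit (obj X n) (x \<oplus>\<^bsub>obj X n\<^esub> y)
      = K_unit (obj X n) x \<oplus>\<^bsub>obj (K_complex X) n\<^esub> K_unit (obj X n) y"
    using x by (simp add: K_unit_def K_complex_simps)
  show "dplus (K_complex X) n (K_unit (obj X n) x) \<oplus>\<^bsub>obj (K_complex X) (n - 1)\<^esub> K_unit (obj X (n - 1)) (dminus X n x)
      = dminus (K_complex X) n (K_unit (obj X n) x) \<oplus>\<^bsub>obj (K_complex X) (n - 1)\<^esub> K_unit (obj X (n - 1)) (dplus X n x)"
    using x by (simp add: K_unit_def K_complex_simps compl.K_module_zero)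
      (intro deg.M.K_cl_eqI, simp_all add: deg.M.a_ac)
qed (rule K_complex_cancellative)

text \<open>
  Bounding chains \<open>u\<^sub>1 - u\<^sub>2\<close> and \<open>v\<^sub>1 - v\<^sub>2\<close> in the completion are replaced by \<open>u\<^sub>1 + v\<^sub>2\<close> and
  \<open>v\<^sub>1 + u\<^sub>2\<close>: only the difference of the two chains in a homology relation matters.
\<close>
lemma K_unit_reflects_homologous:
  assumes canc: "\<And>n. cancellative (obj X n)" and x: "x \<in> cycles X n" "y \<in> cycles X n"
    and h: "(K_unit (obj X n) x, K_unit (obj X n) y) \<in> homologous (K_complex X) n"
  shows "(x, y) \<in> homologous X n"
proof -
  let ?M = "obj X n" let ?N = "obj X (n + 1)"
  interpret KX: semi_chain_complex "K_ring R" "K_complex X" by (rule K_semi_chain_complex)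
  obtain u v where u: "u \<in> carrier (K_module ?N)" "v \<in> carrier (K_module ?N)"
    and e: "K_unit ?M x \<oplus>\<^bsub>K_module ?M\<^esub> dplus (K_complex X) (n + 1) u \<oplus>\<^bsub>K_module ?M\<^esub> dminus (K_complex X) (n + 1) v
      = K_unit ?M y \<oplus>\<^bsub>K_module ?M\<^esub> dplus (K_complex X) (n + 1) v \<oplus>\<^bsub>K_module ?M\<^esub> dminus (K_complex X) (n + 1) u"
    using h by (elim KX.homologousE) (auto simp: K_complex_simps)
  obtain u1 u2 where u': "u1 \<in> carrier ?N" "u2 \<in> carrier ?N" "u = K_cl ?N u1 u2" using u(1) by (rule compl.K_carrierE)
  obtain v1 v2 where v': "v1 \<in> carrier ?N" "v2 \<in> carrier ?N" "v = K_cl ?N v1 v2" using u(2) by (rule compl.K_carrierE)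
  note c = u'(1,2) v'(1,2) x[THEN cyclesD(1)]
  have dz: "dminus (K_complex X) (n + 1) w = K_cl ?M \<zero>\<^bsub>?M\<^esub> \<zero>\<^bsub>?M\<^esub>" for w
    by (simp add: K_complex_simps compl.K_module_zero)
  have d: "dplus (K_complex X) (n + 1) (K_cl ?N s t) = K_cl ?M
      (dplus X (n + 1) s \<oplus>\<^bsub>?M\<^esub> dminus X (n + 1) t) (dplus X (n + 1) t \<oplus>\<^bsub>?M\<^esub> dminus X (n + 1) s)"
    if "s \<in> carrier ?N" "t \<in> carrier ?N" for s t
    using K_complex_dplus[OF that] by simp
  have "K_cl ?M (x \<oplus>\<^bsub>?M\<^esub> (dplus X (n + 1) u1 \<oplus>\<^bsub>?M\<^esub> dminus X (n + 1) u2)) (dplus X (n + 1) u2 \<oplus>\<^bsub>?M\<^esub> dminus X (n + 1) u1)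
      = K_cl ?M (y \<oplus>\<^bsub>?M\<^esub> (dplus X (n + 1) v1 \<oplus>\<^bsub>?M\<^esub> dminus X (n + 1) v2)) (dplus X (n + 1) v2 \<oplus>\<^bsub>?M\<^esub> dminus X (n + 1) v1)"
    using e c unfolding K_unit_def dz u'(3) v'(3) by (simp add: d)
  then have e': "x \<oplus>\<^bsub>?M\<^esub> (dplus X (n + 1) u1 \<oplus>\<^bsub>?M\<^esub> dminus X (n + 1) u2) \<oplus>\<^bsub>?M\<^esub> (dplus X (n + 1) v2 \<oplus>\<^bsub>?M\<^esub> dminus X (n + 1) v1)
      = (dplus X (n + 1) u2 \<oplus>\<^bsub>?M\<^esub> dminus X (n + 1) u1) \<oplus>\<^bsub>?M\<^esub> (y \<oplus>\<^bsub>?M\<^esub> (dplus X (n + 1) v1 \<oplus>\<^bsub>?M\<^esub> dminus X (n + 1) v2))"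
    using c by (subst (asm) compl.cancellative_K_cl_eq_iff[OF canc]) simp_all
  show ?thesis
    by (rule homologousI[OF x, of "u1 \<oplus>\<^bsub>?N\<^esub> v2" "v1 \<oplus>\<^bsub>?N\<^esub> u2"]) (use e' c in \<open>simp_all add: deg.M.a_ac\<close>)
qed

text \<open>
  It is this injectivity that allows a comparison of subsets of \<open>H(G)\<close> to be made inside
  \<open>H(K(G))\<close>.
\<close>
lemma inj_homology_K_unit:
  assumes canc: "\<And>n. cancellative (obj X n)"
  shows "inj_on (homology_map (K_complex X) n (\<lambda>n. K_unit (obj X n))) (carrier (homology X n))"
proof (rule inj_onI)
  interpret unit: complex_map R X "K_ring R" "K_complex X" "\<lambda>n. K_unit (obj X n)"
    by (rule K_unit_complex_map)
  fix C D assume "C \<in> carrier (homology X n)" "D \<in> carrier (homology X n)"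
    and e: "homology_map (K_complex X) n (\<lambda>n. K_unit (obj X n)) C = homology_map (K_complex X) n (\<lambda>n. K_unit (obj X n)) D"
  then obtain x y where x: "x \<in> cycles X n" "C = hcl X n x" "y \<in> cycles X n" "D = hcl X n y"
    by (auto simp: homology_carrier)
  then have "(K_unit (obj X n) x, K_unit (obj X n) y) \<in> homologous (K_complex X) n"
    using e unit.Y.hcl_eq_iff[OF unit.map_cycle unit.map_cycle] by (simp add: unit.homology_map_class)
  then show "C = D"
    using x K_unit_reflects_homologous[OF canc x(1,3)] hcl_eq_iff by simp
qed

end

lemma (in complex_map) K_map_complex_map:
  assumes "\<And>n. cancellative (obj X n)"
  shows "complex_map (K_ring R) (K_complex X) (K_ring S) (K_complex Y) (\<lambda>n. K_map (obj Y n) (f n))"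
proof (intro complex_map.intro complex_map_axioms.intro X.K_semi_chain_complex Y.K_semi_chain_complex)
  have K: "K_map (obj Y n) (f n) (K_cl (obj X n) a b) = K_cl (obj Y n) (f n a) (f n b)"
    if "a \<in> carrier (obj X n)" "b \<in> carrier (obj X n)" for n a b
    by (rule X.compl.K_map_K_cl[OF Y.deg.semimodule_axioms]) (use that in auto)
  fix n x y assume "x \<in> carrier (obj (K_complex X) n)"
  then obtain a b where x: "a \<in> carrier (obj X n)" "b \<in> carrier (obj X n)" "x = K_cl (obj X n) a b"
    by (auto simp: X.K_complex_simps elim: X.compl.K_carrierE)
  show "K_map (obj Y n) (f n) x \<in> carrier (obj (K_complex Y) n)"
    using x by (simp add: K Y.K_complex_simps)
  show "K_map (obj Y n) (f n) (x \<oplus>\<^bsub>obj (K_complex X) n\<^esub> y)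
      = K_map (obj Y n) (f n) x \<oplus>\<^bsub>obj (K_complex Y) n\<^esub> K_map (obj Y n) (f n) y"
    if y: "y \<in> carrier (obj (K_complex X) n)"
  proof -
    obtain c d where "c \<in> carrier (obj X n)" "d \<in> carrier (obj X n)" "y = K_cl (obj X n) c d"
      by (rule X.compl.K_carrierE[OF y[unfolded X.K_complex_simps(1)]])
    with x show ?thesis by (simp add: K X.K_complex_simps Y.K_complex_simps)
  qed
  let ?M = "obj Y (n - 1)"
  have z: "K_map ?M (f (n - 1)) \<zero>\<^bsub>K_module (obj X (n - 1))\<^esub> = \<zero>\<^bsub>K_module ?M\<^esub>"
    by (simp add: X.compl.K_module_zero Y.compl.K_module_zero K) (intro Y.deg.M.K_cl_eqI, simp_all)
  have "dplus Y n (f n a) \<oplus>\<^bsub>?M\<^esub> dminus Y n (f n b) \<oplus>\<^bsub>?M\<^esub> (f (n - 1) (dplus X n b) \<oplus>\<^bsub>?M\<^esub> f (n - 1) (dminus X n a))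
      = (dplus Y n (f n a) \<oplus>\<^bsub>?M\<^esub> f (n - 1) (dminus X n a)) \<oplus>\<^bsub>?M\<^esub> (dminus Y n (f n b) \<oplus>\<^bsub>?M\<^esub> f (n - 1) (dplus X n b))"
    using x by (simp add: Y.deg.M.a_ac)
  also have "\<dots> = (dminus Y n (f n a) \<oplus>\<^bsub>?M\<^esub> f (n - 1) (dplus X n a)) \<oplus>\<^bsub>?M\<^esub> (dplus Y n (f n b) \<oplus>\<^bsub>?M\<^esub> f (n - 1) (dminus X n b))"
    by (simp only: map_d x(1,2))
  also have "\<dots> = dplus Y n (f n b) \<oplus>\<^bsub>?M\<^esub> dminus Y n (f n a) \<oplus>\<^bsub>?M\<^esub> (f (n - 1) (dplus X n a) \<oplus>\<^bsub>?M\<^esub> f (n - 1) (dminus X n b))"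
    using x by (simp add: Y.deg.M.a_ac)
  finally have "K_cl ?M (dplus Y n (f n a) \<oplus>\<^bsub>?M\<^esub> dminus Y n (f n b)) (dplus Y n (f n b) \<oplus>\<^bsub>?M\<^esub> dminus Y n (f n a))
      = K_cl ?M (f (n - 1) (dplus X n a \<oplus>\<^bsub>obj X (n - 1)\<^esub> dminus X n b)) (f (n - 1) (dplus X n b \<oplus>\<^bsub>obj X (n - 1)\<^esub> dminus X n a))"
    using x by (intro Y.deg.M.K_cl_eqI) simp_all
  then show "dplus (K_complex Y) n (K_map (obj Y n) (f n) x) \<oplus>\<^bsub>obj (K_complex Y) (n - 1)\<^esub>
        K_map (obj Y (n - 1)) (f (n - 1)) (dminus (K_complex X) n x)
      = dminus (K_complex Y) n (K_map (obj Y n) (f n) x) \<oplus>\<^bsub>obj (K_complex Y) (n - 1)\<^esub>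
        K_map (obj Y (n - 1)) (f (n - 1)) (dplus (K_complex X) n x)"
    using x by (simp add: K X.K_complex_simps Y.K_complex_simps z Y.compl.K.M.a_comm)
qed (rule Y.K_complex_cancellative)

section \<open>Schreier extensions by modules\<close>

locale schreier_homology =
  A: semi_chain_complex R A + B: semi_chain_complex R B + G: semi_chain_complex R G
  for R :: "('r, 'm) ring_scheme" and A :: "('r, 'a) semi_complex"
    and B :: "('r, 'b) semi_complex" and G :: "('r, 'c) semi_complex" +
  fixes \<kappa> :: "int \<Rightarrow> 'a \<Rightarrow> 'b" and \<sigma> :: "int \<Rightarrow> 'b \<Rightarrow> 'c"
  assumes ses: "schreier_ses R A B G \<kappa> \<sigma>"
    and A_cancellative: "cancellative (obj A n)"
    and dminus_representatives: "dminus_preserves_representatives A B \<kappa> \<sigma> n"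
    and G_group: "abelian_group (obj G n)"
    and G_dminus [simp]: "dminus G n c = \<zero>\<^bsub>obj G (n - 1)\<^esub>"
begin

sublocale GG: abelian_group "obj G n" for n
  by (rule G_group)

abbreviation rep :: "int \<Rightarrow> 'b \<Rightarrow> bool" where
  "rep n \<equiv> representative (obj A n) (obj B n) (\<kappa> n) (\<sigma> n)"

lemma extension: "schreier_extension R (obj A n) (obj B n) (obj G n) (\<kappa> n) (\<sigma> n)"
  using ses by (simp add: schreier_ses_def)

lemma chain_morphisms: "chain_morphism R A B \<kappa>" "chain_morphism R B G \<sigma>"
  using ses by (simp_all add: schreier_ses_def)

lemma kappa_hom: "\<kappa> n \<in> semimodule_hom R (obj A n) (obj B n)"
  and sigma_hom: "\<sigma> n \<in> semimodule_hom R (obj B n) (obj G n)"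
  using extension by (simp_all add: schreier_extension_def)

lemma kappa_zero [simp]: "\<kappa> n \<zero>\<^bsub>obj A n\<^esub> = \<zero>\<^bsub>obj B n\<^esub>"
  and sigma_zero [simp]: "\<sigma> n \<zero>\<^bsub>obj B n\<^esub> = \<zero>\<^bsub>obj G n\<^esub>"
  by (rule semimodule_hom_zero[OF _ _ kappa_hom] semimodule_hom_zero[OF _ _ sigma_hom];
      rule A.deg.semimodule_axioms B.deg.semimodule_axioms G.deg.semimodule_axioms)+

lemma kappa_eq_iff [simp]:
  "x \<in> carrier (obj A n) \<Longrightarrow> y \<in> carrier (obj A n) \<Longrightarrow> \<kappa> n x = \<kappa> n y \<longleftrightarrow> x = y"
  using extension[of n] by (auto simp: schreier_extension_def dest: inj_onD)

lemma sigma_kappa [simp]: "x \<in> carrier (obj A n) \<Longrightarrow> \<sigma> n (\<kappa> n x) = \<zero>\<^bsub>obj G n\<^esub>"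
  using extension[of n] by (auto simp: schreier_extension_def a_kernel_def')

lemma ex_rep:
  assumes "c \<in> carrier (obj G n)"
  obtains u where "rep n u" "u \<in> carrier (obj B n)" "\<sigma> n u = c"
  using extension[of n] assms by (auto simp: schreier_extension_def representative_def)

lemma rep_translate:
  assumes "rep n u" "b \<in> carrier (obj B n)" "\<sigma> n b = \<sigma> n u"
  obtains a where "a \<in> carrier (obj A n)" "b = \<kappa> n a \<oplus>\<^bsub>obj B n\<^esub> u"
  using assms unfolding representative_def by blast

text \<open>
  An equation \<open>b + b' = b + b''\<close> forces \<open>b'\<close> and \<open>b''\<close> into the same fibre, so they are translates
  of one representative by \<open>a'\<close> and \<open>a''\<close>. Adding some \<open>v\<close> over \<open>-\<sigma>(b)\<close> moves \<open>b\<close> into \<open>\<kappa>(A\<^sub>n)\<close>;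
  uniqueness of the decomposition then reduces the claim to cancellation in \<open>A\<^sub>n\<close>.
\<close>
lemma B_cancellative: "cancellative (obj B n)"
  unfolding cancellative_def
proof (intro ballI impI)
  let ?B = "obj B n"
  note k = semimodule_homD[OF kappa_hom] and s = semimodule_homD[OF sigma_hom]
  fix b b' b'' assume b: "b \<in> carrier ?B" "b' \<in> carrier ?B" "b'' \<in> carrier ?B"
    and e: "b \<oplus>\<^bsub>?B\<^esub> b' = b \<oplus>\<^bsub>?B\<^esub> b''"
  note sb = b[THEN s(1)]
  have "\<sigma> n b \<oplus>\<^bsub>obj G n\<^esub> \<sigma> n b' = \<sigma> n b \<oplus>\<^bsub>obj G n\<^esub> \<sigma> n b''"
    using arg_cong[OF e, of "\<sigma> n"] b by (simp add: s)
  then have s': "\<sigma> n b' = \<sigma> n b''"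
    by (rule cancellativeD[OF abelian_group_cancellative[OF G_group] sb])
  obtain u where u: "rep n u" "u \<in> carrier ?B" "\<sigma> n u = \<sigma> n b''"
    using ex_rep[OF sb(3)] .
  obtain a' where a': "a' \<in> carrier (obj A n)" "b' = \<kappa> n a' \<oplus>\<^bsub>?B\<^esub> u"
    using rep_translate[OF u(1) b(2)] s' u(3) by auto
  obtain a'' where a'': "a'' \<in> carrier (obj A n)" "b'' = \<kappa> n a'' \<oplus>\<^bsub>?B\<^esub> u"
    using rep_translate[OF u(1) b(3)] u(3) by auto
  obtain v where v: "v \<in> carrier ?B" "\<sigma> n v = \<ominus>\<^bsub>obj G n\<^esub> \<sigma> n b"
    using ex_rep[of "\<ominus>\<^bsub>obj G n\<^esub> \<sigma> n b" n] sb by auto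
  have "v \<oplus>\<^bsub>?B\<^esub> b \<in> a_kernel ?B (obj G n) (\<sigma> n)"
    using v b sb by (simp add: a_kernel_def' s GG.l_neg)
  then have "v \<oplus>\<^bsub>?B\<^esub> b \<in> \<kappa> n ` carrier (obj A n)"
    using extension[of n] by (simp add: schreier_extension_def)
  then obtain f where f: "f \<in> carrier (obj A n)" "v \<oplus>\<^bsub>?B\<^esub> b = \<kappa> n f"
    by blast
  have "\<kappa> n (f \<oplus>\<^bsub>obj A n\<^esub> a') \<oplus>\<^bsub>?B\<^esub> u = v \<oplus>\<^bsub>?B\<^esub> (b \<oplus>\<^bsub>?B\<^esub> b')"
    using f(1) a' b(1) v(1) u(2) by (simp add: k f(2)[symmetric] B.deg.M.a_assoc)
  also have "\<dots> = \<kappa> n (f \<oplus>\<^bsub>obj A n\<^esub> a'') \<oplus>\<^bsub>?B\<^esub> u"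
    unfolding e using f(1) a'' b(1) v(1) u(2) by (simp add: k f(2)[symmetric] B.deg.M.a_assoc)
  finally have "\<kappa> n (f \<oplus>\<^bsub>obj A n\<^esub> a') \<oplus>\<^bsub>?B\<^esub> u = \<kappa> n (f \<oplus>\<^bsub>obj A n\<^esub> a'') \<oplus>\<^bsub>?B\<^esub> u" .
  moreover have "\<exists>!a. a \<in> carrier (obj A n) \<and> \<kappa> n (f \<oplus>\<^bsub>obj A n\<^esub> a') \<oplus>\<^bsub>?B\<^esub> u = \<kappa> n a \<oplus>\<^bsub>?B\<^esub> u"
  proof -
    have "\<kappa> n (f \<oplus>\<^bsub>obj A n\<^esub> a') \<in> carrier ?B" "\<sigma> n (\<kappa> n (f \<oplus>\<^bsub>obj A n\<^esub> a')) = \<zero>\<^bsub>obj G n\<^esub>"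
      using f(1) a'(1) k(1) by (simp_all only: A.deg.M.a_closed sigma_kappa)
    then show ?thesis using u sb by (intro u(1)[unfolded representative_def, THEN conjunct2, rule_format]) (simp_all add: s)
  qed
  ultimately have "f \<oplus>\<^bsub>obj A n\<^esub> a' = f \<oplus>\<^bsub>obj A n\<^esub> a''"
    using f(1) a'(1) a''(1) by (blast intro: A.deg.M.a_closed)
  then have "a' = a''" by (rule cancellativeD[OF A_cancellative f(1) a'(1) a''(1)])
  then show "b' = b''" using a' a'' by simp
qed

sublocale incl: complex_map R A R B \<kappa>
  using homology_map_semimodule_hom(1)[OF A.complex B.complex chain_morphisms(1) B_cancellative] .

sublocale proj: complex_map R B R G \<sigma>
  using homology_map_semimodule_hom(1)[OF B.complex G.complex chain_morphisms(2)
      abelian_group_cancellative[OF G_group]] .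

lemma kappa_cycle_iff:
  assumes "a \<in> carrier (obj A n)"
  shows "\<kappa> n a \<in> cycles B n \<longleftrightarrow> a \<in> cycles A n"
  using assms incl.map_d_eq_iff[OF assms] by (simp add: cycles_def)

text \<open>
  Both elements are translates \<open>\<kappa>(y) + u\<close> and \<open>\<kappa>(x) + u\<close> of a representative \<open>u\<close>.
\<close>
lemma same_fibre:
  assumes "b \<in> carrier (obj B n)" "b' \<in> carrier (obj B n)" "\<sigma> n b = \<sigma> n b'"
  obtains x y where "x \<in> carrier (obj A n)" "y \<in> carrier (obj A n)"
    "\<kappa> n x \<oplus>\<^bsub>obj B n\<^esub> b = \<kappa> n y \<oplus>\<^bsub>obj B n\<^esub> b'"
proof -
  obtain u where u: "rep n u" "u \<in> carrier (obj B n)" "\<sigma> n u = \<sigma> n b'"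
    using ex_rep[OF proj.map_closed[OF assms(2)]] .
  obtain y where y: "y \<in> carrier (obj A n)" "b = \<kappa> n y \<oplus>\<^bsub>obj B n\<^esub> u"
    using rep_translate[OF u(1) assms(1)] u(3) assms(3) by auto
  obtain x where x: "x \<in> carrier (obj A n)" "b' = \<kappa> n x \<oplus>\<^bsub>obj B n\<^esub> u"
    using rep_translate[OF u(1) assms(2)] u(3) by auto
  show thesis using that[OF x(1) y(1)] x y u(2) by (simp add: B.deg.M.a_ac)
qed

lemma sigma_dplus:
  assumes "b \<in> carrier (obj B n)"
  shows "\<sigma> (n - 1) (dplus B n b) = dplus G n (\<sigma> n b) \<oplus>\<^bsub>obj G (n - 1)\<^esub> \<sigma> (n - 1) (dminus B n b)"
  using proj.map_d[OF assms] assms by simp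

lemma G_cycles_iff: "c \<in> cycles G n \<longleftrightarrow> c \<in> carrier (obj G n) \<and> dplus G n c = \<zero>\<^bsub>obj G (n - 1)\<^esub>"
  by (simp add: cycles_def)

text \<open>
  In the ordinary complex of groups \<open>G\<close> one bounding chain suffices, namely the difference of the two.
\<close>
lemma G_homologousE:
  assumes "(c, c') \<in> homologous G n"
  obtains w where "w \<in> carrier (obj G (n + 1))" "c \<in> cycles G n" "c' \<in> cycles G n"
    "c \<oplus>\<^bsub>obj G n\<^esub> dplus G (n + 1) w = c'"
proof -
  obtain u v where u: "c \<in> cycles G n" "c' \<in> cycles G n"
    "u \<in> carrier (obj G (n + 1))" "v \<in> carrier (obj G (n + 1))"
    and e: "c \<oplus>\<^bsub>obj G n\<^esub> dplus G (n + 1) u \<oplus>\<^bsub>obj G n\<^esub> dminus G (n + 1) v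
       = c' \<oplus>\<^bsub>obj G n\<^esub> dplus G (n + 1) v \<oplus>\<^bsub>obj G n\<^esub> dminus G (n + 1) u"
    using assms by (rule G.homologousE)
  let ?w = "u \<ominus>\<^bsub>obj G (n + 1)\<^esub> v"
  have c: "c \<in> carrier (obj G n)" "c' \<in> carrier (obj G n)" using u G.cyclesD(1) by auto
  have w: "?w \<in> carrier (obj G (n + 1))" using u(3,4) by (rule GG.minus_closed)
  have "?w \<oplus>\<^bsub>obj G (n + 1)\<^esub> v = u"
    using u(3,4) by (simp add: GG.minus_eq G.deg.M.a_assoc GG.l_neg)
  then have du: "dplus G (n + 1) ?w \<oplus>\<^bsub>obj G n\<^esub> dplus G (n + 1) v = dplus G (n + 1) u"
    using G.d_add(1)[OF w u(4)] by simp
  have "dplus G (n + 1) v \<oplus>\<^bsub>obj G n\<^esub> (c \<oplus>\<^bsub>obj G n\<^esub> dplus G (n + 1) ?w)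
      = c \<oplus>\<^bsub>obj G n\<^esub> (dplus G (n + 1) ?w \<oplus>\<^bsub>obj G n\<^esub> dplus G (n + 1) v)"
    using c u(3,4) w by (simp add: G.deg.M.a_ac)
  also have "\<dots> = dplus G (n + 1) v \<oplus>\<^bsub>obj G n\<^esub> c'"
    unfolding du using e c u(3,4) by (simp add: G.deg.M.a_ac)
  finally have "c \<oplus>\<^bsub>obj G n\<^esub> dplus G (n + 1) ?w = c'"
    by (rule cancellativeD[OF proj.target_cancellative, rotated -1]) (use c u(3,4) w in simp_all)
  then show thesis using that w u by blast
qed

section \<open>Lifts through the completion\<close>

text \<open>
  In \<open>K(B)\<close> this reads \<open>\<partial>(q - p) = \<kappa>(a - a')\<close>. All terms stay in \<open>B\<close>, and their order is that of
  the equation defining \<open>homologous\<close>, so that for cycles \<open>a\<close> and \<open>a'\<close> the existence of a lift is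
  literally homology of \<open>\<kappa>(a')\<close> and \<open>\<kappa>(a)\<close>.
\<close>
definition lift :: "int \<Rightarrow> 'b \<Rightarrow> 'b \<Rightarrow> 'a \<Rightarrow> 'a \<Rightarrow> bool" where
  "lift n q p a a' \<longleftrightarrow> q \<in> carrier (obj B n) \<and> p \<in> carrier (obj B n) \<and>
     a \<in> carrier (obj A (n - 1)) \<and> a' \<in> carrier (obj A (n - 1)) \<and>
     \<kappa> (n - 1) a' \<oplus>\<^bsub>obj B (n - 1)\<^esub> dplus B n q \<oplus>\<^bsub>obj B (n - 1)\<^esub> dminus B n p
       = \<kappa> (n - 1) a \<oplus>\<^bsub>obj B (n - 1)\<^esub> dplus B n p \<oplus>\<^bsub>obj B (n - 1)\<^esub> dminus B n q"

lemma liftD: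
  assumes "lift n q p a a'"
  shows "q \<in> carrier (obj B n)" "p \<in> carrier (obj B n)"
    "a \<in> carrier (obj A (n - 1))" "a' \<in> carrier (obj A (n - 1))"
    "\<kappa> (n - 1) a' \<oplus>\<^bsub>obj B (n - 1)\<^esub> dplus B n q \<oplus>\<^bsub>obj B (n - 1)\<^esub> dminus B n p
       = \<kappa> (n - 1) a \<oplus>\<^bsub>obj B (n - 1)\<^esub> dplus B n p \<oplus>\<^bsub>obj B (n - 1)\<^esub> dminus B n q"
  using assms unfolding lift_def by auto

lemma lift_add:
  assumes l: "lift n q p a a'" and l': "lift n q' p' b b'"
  shows "lift n (q \<oplus>\<^bsub>obj B n\<^esub> q') (p \<oplus>\<^bsub>obj B n\<^esub> p') (a \<oplus>\<^bsub>obj A (n - 1)\<^esub> b) (a' \<oplus>\<^bsub>obj A (n - 1)\<^esub> b')"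
proof -
  let ?M = "obj B (n - 1)"
  note c = liftD(1-4)[OF l] liftD(1-4)[OF l']
  have "\<kappa> (n - 1) (a' \<oplus>\<^bsub>obj A (n - 1)\<^esub> b') \<oplus>\<^bsub>?M\<^esub> dplus B n (q \<oplus>\<^bsub>obj B n\<^esub> q') \<oplus>\<^bsub>?M\<^esub> dminus B n (p \<oplus>\<^bsub>obj B n\<^esub> p')
     = (\<kappa> (n - 1) a' \<oplus>\<^bsub>?M\<^esub> dplus B n q \<oplus>\<^bsub>?M\<^esub> dminus B n p) \<oplus>\<^bsub>?M\<^esub>
       (\<kappa> (n - 1) b' \<oplus>\<^bsub>?M\<^esub> dplus B n q' \<oplus>\<^bsub>?M\<^esub> dminus B n p')"
    using c by (simp add: B.deg.M.a_ac)
  also have "\<dots> = \<kappa> (n - 1) (a \<oplus>\<^bsub>obj A (n - 1)\<^esub> b) \<oplus>\<^bsub>?M\<^esub> dplus B n (p \<oplus>\<^bsub>obj B n\<^esub> p') \<oplus>\<^bsub>?M\<^esub> dminus B n (q \<oplus>\<^bsub>obj B n\<^esub> q')"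
    unfolding liftD(5)[OF l] liftD(5)[OF l'] using c by (simp add: B.deg.M.a_ac)
  finally show ?thesis using c unfolding lift_def by simp
qed

lemma lift_smult:
  assumes r: "r \<in> carrier R" and l: "lift n q p a a'"
  shows "lift n (r \<odot>\<^bsub>obj B n\<^esub> q) (r \<odot>\<^bsub>obj B n\<^esub> p) (r \<odot>\<^bsub>obj A (n - 1)\<^esub> a) (r \<odot>\<^bsub>obj A (n - 1)\<^esub> a')"
  using arg_cong[OF liftD(5)[OF l], of "\<lambda>z. r \<odot>\<^bsub>obj B (n - 1)\<^esub> z"] liftD(1-4)[OF l] r
  unfolding lift_def
  by (simp add: B.deg.smult_r_distr semimodule_homD(3)[OF kappa_hom])

lemma lift_rep_iff:
  assumes "u \<in> carrier (obj B n)" "a \<in> carrier (obj A (n - 1))"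
  shows "lift n u \<zero>\<^bsub>obj B n\<^esub> a \<zero>\<^bsub>obj A (n - 1)\<^esub> \<longleftrightarrow>
    dplus B n u = \<kappa> (n - 1) a \<oplus>\<^bsub>obj B (n - 1)\<^esub> dminus B n u"
  using assms by (simp add: lift_def)

lemma homologous_kappa_iff:
  assumes "a \<in> cycles A (n - 1)" "a' \<in> cycles A (n - 1)"
  shows "(\<kappa> (n - 1) a', \<kappa> (n - 1) a) \<in> homologous B (n - 1) \<longleftrightarrow> (\<exists>q p. lift n q p a a')"
  using assms A.cyclesD(1) by (auto simp: homologous_def lift_def incl.map_cycle)

lemma lift_cycle:
  assumes l: "lift n q p a \<zero>\<^bsub>obj A (n - 1)\<^esub>"
  shows "a \<in> cycles A (n - 1)"
proof -
  have "\<kappa> (n - 1) a \<in> cycles B (n - 1)"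
    by (rule B.cycle_if_homologous[OF B_cancellative B.cycles_closed(1), of _ _ q p])
      (use liftD[OF l] in simp_all)
  then show ?thesis using kappa_cycle_iff[OF liftD(3)[OF l]] by simp
qed

text \<open>
  Apply \<open>\<sigma>\<close> to the equation of the lift: \<open>\<kappa>\<close> disappears, and writing \<open>\<sigma>\<partial>\<^sup>+\<close> as
  \<open>\<delta>\<sigma> + \<sigma>\<partial>\<^sup>-\<close> leaves the same two \<open>\<partial>\<^sup>-\<close> terms on both sides.
\<close>
lemma dplus_sigma_lift:
  assumes l: "lift n q p a a'"
  shows "dplus G n (\<sigma> n q) = dplus G n (\<sigma> n p)"
proof -
  let ?M = "obj G (n - 1)"
  let ?z = "\<sigma> (n - 1) (dminus B n q) \<oplus>\<^bsub>?M\<^esub> \<sigma> (n - 1) (dminus B n p)"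
  note c = liftD(1-4)[OF l]
  have "?z \<oplus>\<^bsub>?M\<^esub> dplus G n (\<sigma> n q) = ?z \<oplus>\<^bsub>?M\<^esub> dplus G n (\<sigma> n p)"
    using arg_cong[OF liftD(5)[OF l], of "\<sigma> (n - 1)"] c by (simp add: sigma_dplus G.deg.M.a_ac)
  then show ?thesis
    by (rule cancellativeD[OF proj.target_cancellative, rotated -1]) (use c in simp_all)
qed

lemma lift_class:
  assumes l: "lift n q p a a'"
  obtains c where "c \<in> cycles G n" "\<sigma> n q = c \<oplus>\<^bsub>obj G n\<^esub> \<sigma> n p"
proof -
  let ?c = "\<sigma> n q \<ominus>\<^bsub>obj G n\<^esub> \<sigma> n p"
  have s: "\<sigma> n q \<in> carrier (obj G n)" "\<sigma> n p \<in> carrier (obj G n)" using liftD[OF l] by simp_all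
  have c: "?c \<in> carrier (obj G n)" using s by (rule GG.minus_closed)
  have e: "?c \<oplus>\<^bsub>obj G n\<^esub> \<sigma> n p = \<sigma> n q"
    using s by (simp add: GG.minus_eq G.deg.M.a_assoc GG.l_neg)
  have "dplus G n (\<sigma> n p) \<oplus>\<^bsub>obj G (n - 1)\<^esub> dplus G n ?c = dplus G n (\<sigma> n p) \<oplus>\<^bsub>obj G (n - 1)\<^esub> \<zero>\<^bsub>obj G (n - 1)\<^esub>"
    using G.d_add(1)[OF c s(2)] dplus_sigma_lift[OF l] c s unfolding e by (simp add: G.deg.M.a_comm)
  then have "dplus G n ?c = \<zero>\<^bsub>obj G (n - 1)\<^esub>"
    by (rule cancellativeD[OF proj.target_cancellative, rotated -1]) (use c s in simp_all)
  then show thesis using that[of ?c] c e by (simp add: G_cycles_iff)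
qed

text \<open>
  For a cycle \<open>c\<close> and a representative \<open>u\<close> over it, \<open>\<partial>\<^sup>+u\<close> and \<open>\<partial>\<^sup>-u\<close> lie in the same fibre, and
  \<open>\<partial>\<^sup>-u\<close> is a representative of it by hypothesis.
\<close>
lemma ex_lift:
  assumes "c \<in> cycles G n"
  obtains u a where "rep n u" "\<sigma> n u = c" "a \<in> cycles A (n - 1)"
    "lift n u \<zero>\<^bsub>obj B n\<^esub> a \<zero>\<^bsub>obj A (n - 1)\<^esub>"
proof -
  obtain u where u: "rep n u" "u \<in> carrier (obj B n)" "\<sigma> n u = c"
    using ex_rep G.cyclesD(1)[OF assms] by blast
  have "rep (n - 1) (dminus B n u)"
    using dminus_representatives[of n] u(1) by (simp add: dminus_preserves_representatives_def)
  moreover have "\<sigma> (n - 1) (dplus B n u) = \<sigma> (n - 1) (dminus B n u)"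
    using sigma_dplus[OF u(2)] u assms by (simp add: G_cycles_iff)
  ultimately obtain a where a: "a \<in> carrier (obj A (n - 1))"
      "dplus B n u = \<kappa> (n - 1) a \<oplus>\<^bsub>obj B (n - 1)\<^esub> dminus B n u"
    using rep_translate[of "n - 1" "dminus B n u" "dplus B n u"] u(2) by auto
  then have "lift n u \<zero>\<^bsub>obj B n\<^esub> a \<zero>\<^bsub>obj A (n - 1)\<^esub>" using lift_rep_iff u(2) by blast
  then show thesis using that u lift_cycle by blast
qed

text \<open>
  The condition on \<open>\<sigma>\<close> says that the classes of \<open>q - p\<close> and \<open>q' - p'\<close> in \<open>G\<^sub>n\<close> differ by the
  boundary of \<open>\<sigma>(r)\<close>. Then \<open>q + p' + \<partial>\<^sup>+r\<close> and \<open>q' + p + \<partial>\<^sup>-r\<close> become equal after adding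
  \<open>\<kappa>(x)\<close> and \<open>\<kappa>(y)\<close>. Applying \<open>\<partial>\<^sup>+\<close> to this equality and \<open>\<partial>\<^sup>-\<close> to the reversed one, and
  adding, makes the terms in \<open>r\<close> cancel by the chain complex law; the equations of the two lifts
  remove \<open>q\<close>, \<open>p\<close>, \<open>q'\<close>, \<open>p'\<close>, and what remains is a relation between elements of \<open>\<kappa>(A)\<close>.
\<close>
lemma lifts_agree:
  assumes l: "lift n q p a a'" and l': "lift n q' p' b b'"
    and r: "r \<in> carrier (obj B (n + 1))"
    and s: "\<sigma> n (q \<oplus>\<^bsub>obj B n\<^esub> p' \<oplus>\<^bsub>obj B n\<^esub> dplus B (n + 1) r)
          = \<sigma> n (q' \<oplus>\<^bsub>obj B n\<^esub> p \<oplus>\<^bsub>obj B n\<^esub> dminus B (n + 1) r)"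
  obtains x y where "x \<in> carrier (obj A n)" "y \<in> carrier (obj A n)"
    "(a \<oplus>\<^bsub>obj A (n - 1)\<^esub> b') \<oplus>\<^bsub>obj A (n - 1)\<^esub> dplus A n x \<oplus>\<^bsub>obj A (n - 1)\<^esub> dminus A n y
   = (a' \<oplus>\<^bsub>obj A (n - 1)\<^esub> b) \<oplus>\<^bsub>obj A (n - 1)\<^esub> dplus A n y \<oplus>\<^bsub>obj A (n - 1)\<^esub> dminus A n x"
proof -
  let ?M = "obj B (n - 1)"
  let ?P = "dplus B n" let ?N = "dminus B n"
  let ?pr = "dplus B (n + 1) r" let ?mr = "dminus B (n + 1) r"
  note c = liftD(1-4)[OF l] liftD(1-4)[OF l'] r
  obtain x y where x: "x \<in> carrier (obj A n)" "y \<in> carrier (obj A n)"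
    and e: "\<kappa> n x \<oplus>\<^bsub>obj B n\<^esub> (q \<oplus>\<^bsub>obj B n\<^esub> p' \<oplus>\<^bsub>obj B n\<^esub> ?pr) = \<kappa> n y \<oplus>\<^bsub>obj B n\<^esub> (q' \<oplus>\<^bsub>obj B n\<^esub> p \<oplus>\<^bsub>obj B n\<^esub> ?mr)"
    using same_fibre[OF _ _ s] c by auto
  have e_plus: "?P (\<kappa> n x) \<oplus>\<^bsub>?M\<^esub> (?P q \<oplus>\<^bsub>?M\<^esub> ?P p' \<oplus>\<^bsub>?M\<^esub> ?P ?pr)
      = ?P (\<kappa> n y) \<oplus>\<^bsub>?M\<^esub> (?P q' \<oplus>\<^bsub>?M\<^esub> ?P p \<oplus>\<^bsub>?M\<^esub> ?P ?mr)"
    using arg_cong[OF e, of ?P] c x by simp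
  have e_minus: "?N (\<kappa> n x) \<oplus>\<^bsub>?M\<^esub> (?N q \<oplus>\<^bsub>?M\<^esub> ?N p' \<oplus>\<^bsub>?M\<^esub> ?N ?pr)
      = ?N (\<kappa> n y) \<oplus>\<^bsub>?M\<^esub> (?N q' \<oplus>\<^bsub>?M\<^esub> ?N p \<oplus>\<^bsub>?M\<^esub> ?N ?mr)"
    using arg_cong[OF e, of ?N] c x by simp
  let ?L = "\<kappa> (n - 1) (a \<oplus>\<^bsub>obj A (n - 1)\<^esub> b') \<oplus>\<^bsub>?M\<^esub> ?P (\<kappa> n x) \<oplus>\<^bsub>?M\<^esub> ?N (\<kappa> n y)"
  let ?R = "\<kappa> (n - 1) (a' \<oplus>\<^bsub>obj A (n - 1)\<^esub> b) \<oplus>\<^bsub>?M\<^esub> ?P (\<kappa> n y) \<oplus>\<^bsub>?M\<^esub> ?N (\<kappa> n x)"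
  \<comment> \<open>The left-hand side of \<open>e_plus\<close> without \<open>\<partial>\<^sup>+\<kappa>(x)\<close>, together with the right-hand side of
    \<open>e_minus\<close> without \<open>\<partial>\<^sup>-\<kappa>(y)\<close>.\<close>
  let ?z = "(?P q \<oplus>\<^bsub>?M\<^esub> ?P p' \<oplus>\<^bsub>?M\<^esub> ?P ?pr) \<oplus>\<^bsub>?M\<^esub> (?N q' \<oplus>\<^bsub>?M\<^esub> ?N p \<oplus>\<^bsub>?M\<^esub> ?N ?mr)"
  have "?z \<oplus>\<^bsub>?M\<^esub> ?L = \<kappa> (n - 1) a \<oplus>\<^bsub>?M\<^esub> \<kappa> (n - 1) b' \<oplus>\<^bsub>?M\<^esub>
      (?P (\<kappa> n x) \<oplus>\<^bsub>?M\<^esub> (?P q \<oplus>\<^bsub>?M\<^esub> ?P p' \<oplus>\<^bsub>?M\<^esub> ?P ?pr)) \<oplus>\<^bsub>?M\<^esub>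
      (?N (\<kappa> n y) \<oplus>\<^bsub>?M\<^esub> (?N q' \<oplus>\<^bsub>?M\<^esub> ?N p \<oplus>\<^bsub>?M\<^esub> ?N ?mr))"
    using c x by (simp add: B.deg.M.a_ac)
  also have "\<dots> = \<kappa> (n - 1) a \<oplus>\<^bsub>?M\<^esub> \<kappa> (n - 1) b' \<oplus>\<^bsub>?M\<^esub>
      (?P (\<kappa> n y) \<oplus>\<^bsub>?M\<^esub> (?P q' \<oplus>\<^bsub>?M\<^esub> ?P p \<oplus>\<^bsub>?M\<^esub> ?P ?mr)) \<oplus>\<^bsub>?M\<^esub>
      (?N (\<kappa> n x) \<oplus>\<^bsub>?M\<^esub> (?N q \<oplus>\<^bsub>?M\<^esub> ?N p' \<oplus>\<^bsub>?M\<^esub> ?N ?pr))"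
    by (simp only: e_plus e_minus)
  also have "\<dots> = (\<kappa> (n - 1) a \<oplus>\<^bsub>?M\<^esub> ?P p \<oplus>\<^bsub>?M\<^esub> ?N q) \<oplus>\<^bsub>?M\<^esub>
      (\<kappa> (n - 1) b' \<oplus>\<^bsub>?M\<^esub> ?P q' \<oplus>\<^bsub>?M\<^esub> ?N p') \<oplus>\<^bsub>?M\<^esub>
      (?P (\<kappa> n y) \<oplus>\<^bsub>?M\<^esub> ?N (\<kappa> n x)) \<oplus>\<^bsub>?M\<^esub> (?P ?mr \<oplus>\<^bsub>?M\<^esub> ?N ?pr)"
    using c x by (simp add: B.deg.M.a_ac)
  also have "\<dots> = (\<kappa> (n - 1) a' \<oplus>\<^bsub>?M\<^esub> ?P q \<oplus>\<^bsub>?M\<^esub> ?N p) \<oplus>\<^bsub>?M\<^esub>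
      (\<kappa> (n - 1) b \<oplus>\<^bsub>?M\<^esub> ?P p' \<oplus>\<^bsub>?M\<^esub> ?N q') \<oplus>\<^bsub>?M\<^esub>
      (?P (\<kappa> n y) \<oplus>\<^bsub>?M\<^esub> ?N (\<kappa> n x)) \<oplus>\<^bsub>?M\<^esub> (?P ?pr \<oplus>\<^bsub>?M\<^esub> ?N ?mr)"
    by (simp only: liftD(5)[OF l] liftD(5)[OF l'] B.d_d[OF r])
  also have "\<dots> = ?z \<oplus>\<^bsub>?M\<^esub> ?R"
    using c x by (simp add: B.deg.M.a_ac)
  finally have "?z \<oplus>\<^bsub>?M\<^esub> ?L = ?z \<oplus>\<^bsub>?M\<^esub> ?R" .
  then have "?L = ?R"
    by (rule cancellativeD[OF B_cancellative, rotated -1]) (use c x in simp_all)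
  then have "\<kappa> (n - 1) ((a \<oplus>\<^bsub>obj A (n - 1)\<^esub> b') \<oplus>\<^bsub>obj A (n - 1)\<^esub> dplus A n x \<oplus>\<^bsub>obj A (n - 1)\<^esub> dminus A n y)
      = \<kappa> (n - 1) ((a' \<oplus>\<^bsub>obj A (n - 1)\<^esub> b) \<oplus>\<^bsub>obj A (n - 1)\<^esub> dplus A n y \<oplus>\<^bsub>obj A (n - 1)\<^esub> dminus A n x)"
    by (rule incl.map_d_pair[THEN iffD1, rotated -1]) (use c x in simp_all)
  then have "(a \<oplus>\<^bsub>obj A (n - 1)\<^esub> b') \<oplus>\<^bsub>obj A (n - 1)\<^esub> dplus A n x \<oplus>\<^bsub>obj A (n - 1)\<^esub> dminus A n y
      = (a' \<oplus>\<^bsub>obj A (n - 1)\<^esub> b) \<oplus>\<^bsub>obj A (n - 1)\<^esub> dplus A n y \<oplus>\<^bsub>obj A (n - 1)\<^esub> dminus A n x"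
    by (rule kappa_eq_iff[THEN iffD1, rotated -1]) (use c x in simp_all)
  then show thesis by (rule that[OF x])
qed

lemma lifts_homologous:
  assumes l: "lift n q p a \<zero>\<^bsub>obj A (n - 1)\<^esub>" and l': "lift n q' p' b \<zero>\<^bsub>obj A (n - 1)\<^esub>"
    and c: "\<sigma> n q = c \<oplus>\<^bsub>obj G n\<^esub> \<sigma> n p" and c': "\<sigma> n q' = c' \<oplus>\<^bsub>obj G n\<^esub> \<sigma> n p'"
    and h: "(c, c') \<in> homologous G n"
  shows "(a, b) \<in> homologous A (n - 1)"
proof -
  let ?G = "obj G n"
  obtain w where w: "w \<in> carrier (obj G (n + 1))" "c \<in> cycles G n" "c' \<in> cycles G n"
    "c \<oplus>\<^bsub>?G\<^esub> dplus G (n + 1) w = c'" using G_homologousE[OF h] .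
  obtain r where r: "r \<in> carrier (obj B (n + 1))" "\<sigma> (n + 1) r = w" using ex_rep[OF w(1)] by blast
  note m = liftD(1-4)[OF l] liftD(1-4)[OF l'] r(1) w(1) w(2,3)[THEN G.cyclesD(1)]
  have dr: "\<sigma> n (dplus B (n + 1) r) = dplus G (n + 1) w \<oplus>\<^bsub>?G\<^esub> \<sigma> n (dminus B (n + 1) r)"
    using sigma_dplus[OF r(1)] r(2) by simp
  have "\<sigma> n (q \<oplus>\<^bsub>obj B n\<^esub> p' \<oplus>\<^bsub>obj B n\<^esub> dplus B (n + 1) r)
      = (c \<oplus>\<^bsub>?G\<^esub> dplus G (n + 1) w) \<oplus>\<^bsub>?G\<^esub> \<sigma> n p' \<oplus>\<^bsub>?G\<^esub> \<sigma> n p \<oplus>\<^bsub>?G\<^esub> \<sigma> n (dminus B (n + 1) r)"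
    using m by (simp add: c dr G.deg.M.a_ac)
  also have "\<dots> = \<sigma> n (q' \<oplus>\<^bsub>obj B n\<^esub> p \<oplus>\<^bsub>obj B n\<^esub> dminus B (n + 1) r)"
    unfolding w(4) using m by (simp add: c' G.deg.M.a_ac)
  finally obtain x y where "x \<in> carrier (obj A n)" "y \<in> carrier (obj A n)"
    "(a \<oplus>\<^bsub>obj A (n - 1)\<^esub> \<zero>\<^bsub>obj A (n - 1)\<^esub>) \<oplus>\<^bsub>obj A (n - 1)\<^esub> dplus A n x \<oplus>\<^bsub>obj A (n - 1)\<^esub> dminus A n y
   = (\<zero>\<^bsub>obj A (n - 1)\<^esub> \<oplus>\<^bsub>obj A (n - 1)\<^esub> b) \<oplus>\<^bsub>obj A (n - 1)\<^esub> dplus A n y \<oplus>\<^bsub>obj A (n - 1)\<^esub> dminus A n x"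
    by (rule lifts_agree[OF l l' r(1)])
  then show ?thesis
    using m by (intro A.homologousI[of _ _ _ x y] lift_cycle[OF l] lift_cycle[OF l']) simp_all
qed

text \<open>
  Well-definedness of the connecting homomorphism, and the freedom to compute it from arbitrary
  lifts. Sums and multiples of lifts are lifts, whereas sums of representatives need not be
  representatives, so this freedom is what makes linearity immediate.
\<close>
lemma connecting_eq:
  assumes l: "lift n q p a \<zero>\<^bsub>obj A (n - 1)\<^esub>"
    and c: "c \<in> cycles G n" "\<sigma> n q = c \<oplus>\<^bsub>obj G n\<^esub> \<sigma> n p"
  shows "connecting A B \<kappa> \<sigma> n (hcl G n c) = hcl A (n - 1) a"
proof -
  \<comment> \<open>The family whose union defines \<open>connecting\<close>; it has exactly one member.\<close>
  define S where "S = {hcl A (n - 1) a | c' u a. c' \<in> hcl G n c \<and> rep n u \<and> \<sigma> n u = c' \<and>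
     a \<in> cycles A (n - 1) \<and> dplus B n u = \<kappa> (n - 1) a \<oplus>\<^bsub>obj B (n - 1)\<^esub> dminus B n u}"
  have "hcl A (n - 1) a' = hcl A (n - 1) a"
    if "(c, \<sigma> n u) \<in> homologous G n" "rep n u" "a' \<in> cycles A (n - 1)"
      "dplus B n u = \<kappa> (n - 1) a' \<oplus>\<^bsub>obj B (n - 1)\<^esub> dminus B n u" for u a'
  proof -
    have u: "u \<in> carrier (obj B n)" using that(2) by (simp add: representative_def)
    have "lift n u \<zero>\<^bsub>obj B n\<^esub> a' \<zero>\<^bsub>obj A (n - 1)\<^esub>"
      using lift_rep_iff[OF u A.cyclesD(1)[OF that(3)]] that(4) by blast
    from lifts_homologous[OF l this c(2) _ that(1)] have "(a, a') \<in> homologous A (n - 1)"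
      using u by simp
    then show ?thesis using A.hcl_eq_iff[OF lift_cycle[OF l] that(3)] by simp
  qed
  then have "S \<subseteq> {hcl A (n - 1) a}"
    unfolding S_def G.mem_hcl_iff by blast
  moreover obtain u a' where "rep n u" "\<sigma> n u = c" "a' \<in> cycles A (n - 1)"
      "lift n u \<zero>\<^bsub>obj B n\<^esub> a' \<zero>\<^bsub>obj A (n - 1)\<^esub>" using ex_lift[OF c(1)] .
  then have "hcl A (n - 1) a' \<in> S"
    using lift_rep_iff[of u n a'] G.homologous_refl[OF c(1)] A.cyclesD(1)[of a' "n - 1"]
    unfolding S_def G.mem_hcl_iff representative_def by blast
  ultimately have "S = {hcl A (n - 1) a}" by (metis empty_iff subset_singletonD)
  then show ?thesis unfolding connecting_def S_def by simp
qed

lemma connecting_rep: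
  assumes "C \<in> carrier (homology G n)"
  obtains c u a where "c \<in> cycles G n" "C = hcl G n c" "u \<in> carrier (obj B n)" "\<sigma> n u = c" "a \<in> cycles A (n - 1)"
    "lift n u \<zero>\<^bsub>obj B n\<^esub> a \<zero>\<^bsub>obj A (n - 1)\<^esub>" "connecting A B \<kappa> \<sigma> n C = hcl A (n - 1) a"
proof -
  obtain c where c: "c \<in> cycles G n" "C = hcl G n c" using assms by (auto simp: G.homology_carrier)
  obtain u a where u: "\<sigma> n u = c" "a \<in> cycles A (n - 1)" "lift n u \<zero>\<^bsub>obj B n\<^esub> a \<zero>\<^bsub>obj A (n - 1)\<^esub>"
    using ex_lift[OF c(1)] by blast
  show thesis
    using that[OF c _ u] connecting_eq[OF u(3) c(1)] u(1) c(2) liftD(1)[OF u(3)] G.cyclesD(1)[OF c(1)] by simp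
qed

lemma connecting_hom:
  "connecting A B \<kappa> \<sigma> n \<in> semimodule_hom R (homology G n) (homology A (n - 1))"
  unfolding semimodule_hom_def
proof (intro CollectI conjI ballI)
  show "connecting A B \<kappa> \<sigma> n \<in> carrier (homology G n) \<rightarrow> carrier (homology A (n - 1))"
  proof
    fix C assume "C \<in> carrier (homology G n)"
    then show "connecting A B \<kappa> \<sigma> n C \<in> carrier (homology A (n - 1))"
      by (rule connecting_rep) (simp add: A.homology_carrier)
  qed
next
  fix C D assume "C \<in> carrier (homology G n)" "D \<in> carrier (homology G n)"
  obtain c u a where c: "c \<in> cycles G n" "C = hcl G n c" "u \<in> carrier (obj B n)" "\<sigma> n u = c"
    "a \<in> cycles A (n - 1)" "lift n u \<zero>\<^bsub>obj B n\<^esub> a \<zero>\<^bsub>obj A (n - 1)\<^esub>"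
    "connecting A B \<kappa> \<sigma> n C = hcl A (n - 1) a"
    using \<open>C \<in> carrier (homology G n)\<close> by (rule connecting_rep)
  obtain d v b where d: "d \<in> cycles G n" "D = hcl G n d" "v \<in> carrier (obj B n)" "\<sigma> n v = d"
    "b \<in> cycles A (n - 1)" "lift n v \<zero>\<^bsub>obj B n\<^esub> b \<zero>\<^bsub>obj A (n - 1)\<^esub>"
    "connecting A B \<kappa> \<sigma> n D = hcl A (n - 1) b"
    using \<open>D \<in> carrier (homology G n)\<close> by (rule connecting_rep)
  note cd = c(1)[THEN G.cyclesD(1)] d(1)[THEN G.cyclesD(1)]
  have "lift n (u \<oplus>\<^bsub>obj B n\<^esub> v) \<zero>\<^bsub>obj B n\<^esub> (a \<oplus>\<^bsub>obj A (n - 1)\<^esub> b) \<zero>\<^bsub>obj A (n - 1)\<^esub>"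
    using lift_add[OF c(6) d(6)] by simp
  from connecting_eq[OF this G.cycles_closed(2)[OF c(1) d(1)]]
  show "connecting A B \<kappa> \<sigma> n (C \<oplus>\<^bsub>homology G n\<^esub> D)
      = connecting A B \<kappa> \<sigma> n C \<oplus>\<^bsub>homology A (n - 1)\<^esub> connecting A B \<kappa> \<sigma> n D"
    using c d cd by (simp add: G.homology_add A.homology_add)
next
  fix r C assume r: "r \<in> carrier R" and "C \<in> carrier (homology G n)"
  obtain c u a where c: "c \<in> cycles G n" "C = hcl G n c" "u \<in> carrier (obj B n)" "\<sigma> n u = c"
    "a \<in> cycles A (n - 1)" "lift n u \<zero>\<^bsub>obj B n\<^esub> a \<zero>\<^bsub>obj A (n - 1)\<^esub>"
    "connecting A B \<kappa> \<sigma> n C = hcl A (n - 1) a"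
    using \<open>C \<in> carrier (homology G n)\<close> by (rule connecting_rep)
  have "lift n (r \<odot>\<^bsub>obj B n\<^esub> u) \<zero>\<^bsub>obj B n\<^esub> (r \<odot>\<^bsub>obj A (n - 1)\<^esub> a) \<zero>\<^bsub>obj A (n - 1)\<^esub>"
    using lift_smult[OF r c(6)] r by simp
  from connecting_eq[OF this G.cycles_closed(3)[OF r c(1)]]
  show "connecting A B \<kappa> \<sigma> n (r \<odot>\<^bsub>homology G n\<^esub> C)
      = r \<odot>\<^bsub>homology A (n - 1)\<^esub> connecting A B \<kappa> \<sigma> n C"
    using c r G.cyclesD(1)[OF c(1)]
    by (simp add: G.homology_smult A.homology_smult semimodule_homD(3)[OF sigma_hom])
qed

text \<open>
  If \<open>a\<close> is bounded by \<open>y - x\<close>, then correcting \<open>(u, 0)\<close> to \<open>(u + \<kappa>(x), \<kappa>(y))\<close> kills the boundary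
  \<open>\<kappa>(a)\<close> without changing the class in \<open>G\<^sub>n\<close>. The corrected pair is in general not a single element
  of \<open>B\<^sub>n\<close>, which is why the sequence can fail to be exact at \<open>H(G)\<close>.
\<close>
lemma kernel_connecting:
  "a_kernel (homology G n) (homology A (n - 1)) (connecting A B \<kappa> \<sigma> n)
    = {hcl G n c | c q p. c \<in> cycles G n \<and> \<sigma> n q = c \<oplus>\<^bsub>obj G n\<^esub> \<sigma> n p \<and>
         lift n q p \<zero>\<^bsub>obj A (n - 1)\<^esub> \<zero>\<^bsub>obj A (n - 1)\<^esub>}" (is "?K = ?S")
proof (intro equalityI subsetI)
  fix C assume "C \<in> ?S"
  then obtain c q p where c: "C = hcl G n c" "c \<in> cycles G n" "\<sigma> n q = c \<oplus>\<^bsub>obj G n\<^esub> \<sigma> n p"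
    "lift n q p \<zero>\<^bsub>obj A (n - 1)\<^esub> \<zero>\<^bsub>obj A (n - 1)\<^esub>" by blast
  then show "C \<in> ?K"
    by (simp add: a_kernel_def' G.homology_carrier A.homology_zero connecting_eq)
next
  let ?A = "obj A (n - 1)" let ?B = "obj B (n - 1)"
  fix C assume "C \<in> ?K"
  then have C: "C \<in> carrier (homology G n)" "connecting A B \<kappa> \<sigma> n C = hcl A (n - 1) \<zero>\<^bsub>?A\<^esub>"
    by (simp_all add: a_kernel_def' A.homology_zero)
  obtain c u a where c: "c \<in> cycles G n" "C = hcl G n c" "u \<in> carrier (obj B n)" "\<sigma> n u = c"
    "a \<in> cycles A (n - 1)" "lift n u \<zero>\<^bsub>obj B n\<^esub> a \<zero>\<^bsub>?A\<^esub>"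
    "connecting A B \<kappa> \<sigma> n C = hcl A (n - 1) a"
    using C(1) by (rule connecting_rep)
  then have "(a, \<zero>\<^bsub>?A\<^esub>) \<in> homologous A (n - 1)"
    using C(2) A.hcl_eq_iff[OF c(5) A.cycles_closed(1)] by simp
  then obtain x y where x: "x \<in> carrier (obj A n)" "y \<in> carrier (obj A n)"
    and e: "a \<oplus>\<^bsub>?A\<^esub> dplus A n x \<oplus>\<^bsub>?A\<^esub> dminus A n y
       = \<zero>\<^bsub>?A\<^esub> \<oplus>\<^bsub>?A\<^esub> dplus A n y \<oplus>\<^bsub>?A\<^esub> dminus A n x"
    by (elim A.homologousE) auto
  note a = A.cyclesD(1)[OF c(5)] x c(3)
  have k: "\<kappa> (n - 1) a \<oplus>\<^bsub>?B\<^esub> dplus B n (\<kappa> n x) \<oplus>\<^bsub>?B\<^esub> dminus B n (\<kappa> n y)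
      = \<kappa> (n - 1) \<zero>\<^bsub>?A\<^esub> \<oplus>\<^bsub>?B\<^esub> dplus B n (\<kappa> n y) \<oplus>\<^bsub>?B\<^esub> dminus B n (\<kappa> n x)"
    using incl.map_d_pair[OF a(1) A.deg.M.zero_closed x] e by (simp only:)
  have du: "dplus B n u = \<kappa> (n - 1) a \<oplus>\<^bsub>?B\<^esub> dminus B n u"
    using lift_rep_iff a c(6) by blast
  have "dplus B n (u \<oplus>\<^bsub>obj B n\<^esub> \<kappa> n x) \<oplus>\<^bsub>?B\<^esub> dminus B n (\<kappa> n y)
      = dminus B n u \<oplus>\<^bsub>?B\<^esub> (\<kappa> (n - 1) a \<oplus>\<^bsub>?B\<^esub> dplus B n (\<kappa> n x) \<oplus>\<^bsub>?B\<^esub> dminus B n (\<kappa> n y))"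
    using a by (simp add: du B.deg.M.a_ac)
  also have "\<dots> = dplus B n (\<kappa> n y) \<oplus>\<^bsub>?B\<^esub> dminus B n (u \<oplus>\<^bsub>obj B n\<^esub> \<kappa> n x)"
    unfolding k using a by (simp add: B.deg.M.a_ac)
  finally have "lift n (u \<oplus>\<^bsub>obj B n\<^esub> \<kappa> n x) (\<kappa> n y) \<zero>\<^bsub>?A\<^esub> \<zero>\<^bsub>?A\<^esub>"
    using a unfolding lift_def by simp
  moreover have "\<sigma> n (u \<oplus>\<^bsub>obj B n\<^esub> \<kappa> n x) = c \<oplus>\<^bsub>obj G n\<^esub> \<sigma> n (\<kappa> n y)"
    using a c(4) by simp
  ultimately show "C \<in> ?S" using c(1,2) by blast
qed

section \<open>The long homology sequence\<close>

lemma kappa_homology_hom: "homology_map B n \<kappa> \<in> semimodule_hom R (homology A n) (homology B n)"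
  and sigma_homology_hom: "homology_map G n \<sigma> \<in> semimodule_hom R (homology B n) (homology G n)"
  using homology_map_semimodule_hom(2) A.complex B.complex G.complex chain_morphisms
    B_cancellative abelian_group_cancellative[OF G_group] by blast+

text \<open>
  The degree is \<open>n - 1\<close>, here and in the results on exactness at \<open>H(A)\<close> and on normality, because
  the lifts of elements of \<open>A\<close> in this degree have degree \<open>n\<close>.
\<close>
lemma kernel_kappa_iff:
  assumes "a \<in> cycles A (n - 1)"
  shows "hcl A (n - 1) a \<in> a_kernel (homology A (n - 1)) (homology B (n - 1)) (homology_map B (n - 1) \<kappa>)
    \<longleftrightarrow> (\<exists>q p. lift n q p a \<zero>\<^bsub>obj A (n - 1)\<^esub>)"
proof -
  have "hcl A (n - 1) a \<in> a_kernel (homology A (n - 1)) (homology B (n - 1)) (homology_map B (n - 1) \<kappa>)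
    \<longleftrightarrow> hcl B (n - 1) (\<kappa> (n - 1) \<zero>\<^bsub>obj A (n - 1)\<^esub>) = hcl B (n - 1) (\<kappa> (n - 1) a)"
    using assms by (auto simp: a_kernel_def' A.homology_carrier B.homology_zero incl.homology_map_class)
  then show ?thesis
    using homologous_kappa_iff[OF assms A.cycles_closed(1)]
      B.hcl_eq_iff[OF incl.map_cycle[OF A.cycles_closed(1)] incl.map_cycle[OF assms]] by simp
qed

lemma exact_at_A:
  "exact_at R (homology G n) (homology A (n - 1)) (homology B (n - 1))
    (connecting A B \<kappa> \<sigma> n) (homology_map B (n - 1) \<kappa>)"
  unfolding exact_at_def
proof (intro conjI connecting_hom kappa_homology_hom equalityI subsetI)
  let ?K = "a_kernel (homology A (n - 1)) (homology B (n - 1)) (homology_map B (n - 1) \<kappa>)"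
  fix D assume "D \<in> connecting A B \<kappa> \<sigma> n ` carrier (homology G n)"
  then obtain C where C: "C \<in> carrier (homology G n)" "D = connecting A B \<kappa> \<sigma> n C" by blast
  from C(1) show "D \<in> ?K"
    by (rule connecting_rep) (use C(2) kernel_kappa_iff in auto)
next
  let ?K = "a_kernel (homology A (n - 1)) (homology B (n - 1)) (homology_map B (n - 1) \<kappa>)"
  fix D assume D: "D \<in> ?K"
  then obtain a where a: "a \<in> cycles A (n - 1)" "D = hcl A (n - 1) a"
    by (auto simp: a_kernel_def' A.homology_carrier)
  then obtain q p where l: "lift n q p a \<zero>\<^bsub>obj A (n - 1)\<^esub>" using kernel_kappa_iff D by blast
  obtain c where c: "c \<in> cycles G n" "\<sigma> n q = c \<oplus>\<^bsub>obj G n\<^esub> \<sigma> n p" using lift_class[OF l] .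
  show "D \<in> connecting A B \<kappa> \<sigma> n ` carrier (homology G n)"
    using connecting_eq[OF l c] a(2) c(1) by (force simp: G.homology_carrier)
qed

text \<open>
  If \<open>\<sigma>(b)\<close> bounds through \<open>w\<close>, take a representative \<open>r\<close> over \<open>w\<close>. Then \<open>b + \<partial>\<^sup>+r\<close> lies in the fibre
  of the representative \<open>\<partial>\<^sup>-r\<close>, and the resulting \<open>b + \<partial>\<^sup>+r = \<kappa>(a) + \<partial>\<^sup>-r\<close> is a homology
  between \<open>b\<close> and \<open>\<kappa>(a)\<close>.
\<close>
lemma exact_at_B:
  "exact_at R (homology A n) (homology B n) (homology G n) (homology_map B n \<kappa>) (homology_map G n \<sigma>)"
  unfolding exact_at_def
proof (intro conjI kappa_homology_hom sigma_homology_hom equalityI subsetI)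
  let ?K = "a_kernel (homology B n) (homology G n) (homology_map G n \<sigma>)"
  fix D assume "D \<in> homology_map B n \<kappa> ` carrier (homology A n)"
  then obtain a where a: "a \<in> cycles A n" "D = hcl B n (\<kappa> n a)"
    by (auto simp: A.homology_carrier incl.homology_map_class)
  then show "D \<in> ?K"
    using A.cyclesD(1)[OF a(1)] incl.map_cycle[OF a(1)]
    by (simp add: a_kernel_def' B.homology_carrier G.homology_zero proj.homology_map_class)
next
  let ?B = "obj B n"
  fix D assume "D \<in> a_kernel (homology B n) (homology G n) (homology_map G n \<sigma>)"
  then obtain b where b: "b \<in> cycles B n" "D = hcl B n b" and "hcl G n (\<sigma> n b) = hcl G n \<zero>\<^bsub>obj G n\<^esub>"
    by (auto simp: a_kernel_def' B.homology_carrier G.homology_zero proj.homology_map_class)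
  then have "(\<sigma> n b, \<zero>\<^bsub>obj G n\<^esub>) \<in> homologous G n"
    using G.hcl_eq_iff[OF proj.map_cycle[OF b(1)] G.cycles_closed(1)] by simp
  then obtain w where w: "w \<in> carrier (obj G (n + 1))"
    "\<sigma> n b \<oplus>\<^bsub>obj G n\<^esub> dplus G (n + 1) w = \<zero>\<^bsub>obj G n\<^esub>" by (rule G_homologousE)
  obtain r where r: "rep (n + 1) r" "r \<in> carrier (obj B (n + 1))" "\<sigma> (n + 1) r = w"
    using ex_rep[OF w(1)] .
  note m = B.cyclesD(1)[OF b(1)] r(2) w(1)
  have "\<sigma> n (dplus B (n + 1) r) = dplus G (n + 1) w \<oplus>\<^bsub>obj G n\<^esub> \<sigma> n (dminus B (n + 1) r)"
    using sigma_dplus[OF r(2)] r(3) by simp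
  then have "\<sigma> n (b \<oplus>\<^bsub>?B\<^esub> dplus B (n + 1) r)
      = (\<sigma> n b \<oplus>\<^bsub>obj G n\<^esub> dplus G (n + 1) w) \<oplus>\<^bsub>obj G n\<^esub> \<sigma> n (dminus B (n + 1) r)"
    using m by (simp add: G.deg.M.a_ac)
  then have s: "\<sigma> n (b \<oplus>\<^bsub>?B\<^esub> dplus B (n + 1) r) = \<sigma> n (dminus B (n + 1) r)"
    unfolding w(2) using m by simp
  have "rep n (dminus B (n + 1) r)"
    using dminus_representatives[of "n + 1"] r(1) by (simp add: dminus_preserves_representatives_def)
  then obtain a where a: "a \<in> carrier (obj A n)"
    "b \<oplus>\<^bsub>?B\<^esub> dplus B (n + 1) r = \<kappa> n a \<oplus>\<^bsub>?B\<^esub> dminus B (n + 1) r"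
    using rep_translate[OF _ _ s] m by auto
  let ?z = "\<zero>\<^bsub>obj B (n + 1)\<^esub>"
  have z: "dplus B (n + 1) ?z = \<zero>\<^bsub>?B\<^esub>" "dminus B (n + 1) ?z = \<zero>\<^bsub>?B\<^esub>"
    using B.d_zero[of "n + 1"] by simp_all
  have e: "b \<oplus>\<^bsub>?B\<^esub> dplus B (n + 1) r \<oplus>\<^bsub>?B\<^esub> dminus B (n + 1) ?z
      = \<kappa> n a \<oplus>\<^bsub>?B\<^esub> dplus B (n + 1) ?z \<oplus>\<^bsub>?B\<^esub> dminus B (n + 1) r"
    unfolding z a(2) using m a(1) by simp
  have k: "\<kappa> n a \<in> cycles B n"
    by (rule B.cycle_if_homologous[OF B_cancellative b(1) _ _ _ e]) (use m a(1) in simp_all)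
  have "(b, \<kappa> n a) \<in> homologous B n"
    by (rule B.homologousI[OF b(1) k _ _ e]) (use m in simp_all)
  then have "D = hcl B n (\<kappa> n a)" using B.hcl_eq_iff[OF b(1) k] b(2) by simp
  moreover have "a \<in> cycles A n" using k kappa_cycle_iff[OF a(1)] by simp
  ultimately show "D \<in> homology_map B n \<kappa> ` carrier (homology A n)"
    by (force simp: A.homology_carrier incl.homology_map_class)
qed

lemma image_sigma_in_kernel:
  "homology_map G n \<sigma> ` carrier (homology B n)
     \<subseteq> a_kernel (homology G n) (homology A (n - 1)) (connecting A B \<kappa> \<sigma> n)"
proof
  fix D assume "D \<in> homology_map G n \<sigma> ` carrier (homology B n)"
  then obtain b where b: "b \<in> cycles B n" "D = hcl G n (\<sigma> n b)"
    by (auto simp: B.homology_carrier proj.homology_map_class)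
  have "lift n b \<zero>\<^bsub>obj B n\<^esub> \<zero>\<^bsub>obj A (n - 1)\<^esub> \<zero>\<^bsub>obj A (n - 1)\<^esub>"
    using B.cyclesD[OF b(1)] by (simp add: lift_def)
  then have "connecting A B \<kappa> \<sigma> n D = hcl A (n - 1) \<zero>\<^bsub>obj A (n - 1)\<^esub>"
    unfolding b(2) by (rule connecting_eq) (use B.cyclesD(1)[OF b(1)] proj.map_cycle[OF b(1)] in simp_all)
  then show "D \<in> a_kernel (homology G n) (homology A (n - 1)) (connecting A B \<kappa> \<sigma> n)"
    using proj.map_cycle[OF b(1)] b(2) by (simp add: a_kernel_def' G.homology_carrier A.homology_zero)
qed

text \<open>
  A homology between \<open>\<kappa>(a\<^sub>1)\<close> and \<open>\<kappa>(a\<^sub>2)\<close> is a pair over some cycle \<open>c\<close>. If \<open>k\<close> is the value of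
  the connecting homomorphism at \<open>c\<close>, then \<open>k + a\<^sub>1\<close> and \<open>a\<^sub>2\<close> are homologous by \<open>lifts_agree\<close>, and
  \<open>\<kappa>(k)\<close> bounds. So one may take \<open>k\<^sub>2 = 0\<close>.
\<close>
lemma normal_kappa:
  "normal_hom R (homology A (n - 1)) (homology B (n - 1)) (homology_map B (n - 1) \<kappa>)"
  unfolding normal_hom_def
proof (intro conjI ballI impI kappa_homology_hom)
  let ?A = "obj A (n - 1)" let ?H = "homology A (n - 1)"
  let ?K = "a_kernel ?H (homology B (n - 1)) (homology_map B (n - 1) \<kappa>)"
  fix C1 C2 assume "C1 \<in> carrier ?H" "C2 \<in> carrier ?H"
    and eq: "homology_map B (n - 1) \<kappa> C1 = homology_map B (n - 1) \<kappa> C2"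
  then obtain a1 a2 where a: "a1 \<in> cycles A (n - 1)" "C1 = hcl A (n - 1) a1"
      "a2 \<in> cycles A (n - 1)" "C2 = hcl A (n - 1) a2"
    by (auto simp: A.homology_carrier)
  then have "(\<kappa> (n - 1) a1, \<kappa> (n - 1) a2) \<in> homologous B (n - 1)"
    using eq B.hcl_eq_iff[OF incl.map_cycle incl.map_cycle] by (simp add: incl.homology_map_class)
  then obtain q p where l: "lift n q p a2 a1" using homologous_kappa_iff[OF a(3,1)] by blast
  obtain c where c: "c \<in> cycles G n" "\<sigma> n q = c \<oplus>\<^bsub>obj G n\<^esub> \<sigma> n p" using lift_class[OF l] .
  obtain u k where u: "\<sigma> n u = c" "k \<in> cycles A (n - 1)" "lift n u \<zero>\<^bsub>obj B n\<^esub> k \<zero>\<^bsub>?A\<^esub>"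
    using ex_lift[OF c(1)] by blast
  \<comment> \<open>Both pairs lie over \<open>c\<close> itself, so they are compared with zero as the correcting boundary.\<close>
  let ?z = "\<zero>\<^bsub>obj B (n + 1)\<^esub>"
  have z: "dplus B (n + 1) ?z = \<zero>\<^bsub>obj B n\<^esub>" "dminus B (n + 1) ?z = \<zero>\<^bsub>obj B n\<^esub>"
    using B.d_zero[of "n + 1"] by simp_all
  have "\<sigma> n (q \<oplus>\<^bsub>obj B n\<^esub> \<zero>\<^bsub>obj B n\<^esub> \<oplus>\<^bsub>obj B n\<^esub> dplus B (n + 1) ?z)
      = \<sigma> n (u \<oplus>\<^bsub>obj B n\<^esub> p \<oplus>\<^bsub>obj B n\<^esub> dminus B (n + 1) ?z)"
    unfolding z using c(2) u(1) liftD(1,2)[OF l] liftD(1)[OF u(3)] by simp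
  then obtain x y where x: "x \<in> carrier (obj A n)" "y \<in> carrier (obj A n)"
    "(a2 \<oplus>\<^bsub>?A\<^esub> \<zero>\<^bsub>?A\<^esub>) \<oplus>\<^bsub>?A\<^esub> dplus A n x \<oplus>\<^bsub>?A\<^esub> dminus A n y
      = (a1 \<oplus>\<^bsub>?A\<^esub> k) \<oplus>\<^bsub>?A\<^esub> dplus A n y \<oplus>\<^bsub>?A\<^esub> dminus A n x"
    by (rule lifts_agree[OF l u(3) B.deg.M.zero_closed])
  have m: "a1 \<in> carrier ?A" "a2 \<in> carrier ?A" "k \<in> carrier ?A"
    using a u(2) A.cyclesD(1) by auto
  have "(\<zero>\<^bsub>?A\<^esub> \<oplus>\<^bsub>?A\<^esub> a2, k \<oplus>\<^bsub>?A\<^esub> a1) \<in> homologous A (n - 1)"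
    using x a(1,3) u(2) m by (intro A.homologousI[of _ _ _ x y] A.cycles_closed) (simp_all add: A.deg.M.a_ac)
  then have "hcl A (n - 1) k \<oplus>\<^bsub>?H\<^esub> C1 = hcl A (n - 1) \<zero>\<^bsub>?A\<^esub> \<oplus>\<^bsub>?H\<^esub> C2"
    using a u(2) A.hcl_eq_iff[of "\<zero>\<^bsub>?A\<^esub> \<oplus>\<^bsub>?A\<^esub> a2" "n - 1" "k \<oplus>\<^bsub>?A\<^esub> a1"]
    by (simp add: A.homology_add A.cycles_closed)
  moreover have "hcl A (n - 1) k \<in> ?K" using kernel_kappa_iff[OF u(2)] u(3) by blast
  moreover have "hcl A (n - 1) \<zero>\<^bsub>?A\<^esub> \<in> ?K"
    using kernel_kappa_iff[OF A.cycles_closed(1)] lift_rep_iff[of "\<zero>\<^bsub>obj B n\<^esub>" n "\<zero>\<^bsub>?A\<^esub>"] by auto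
  ultimately show "\<exists>k1\<in>?K. \<exists>k2\<in>?K. k1 \<oplus>\<^bsub>?H\<^esub> C1 = k2 \<oplus>\<^bsub>?H\<^esub> C2" by blast
qed

text \<open>
  Cycles of \<open>K(B)\<close> are written as pairs here; cancellation in \<open>B\<close> makes equality of the classes in
  \<open>K(B)\<close> the plain equation in the definition of \<open>lift\<close>.
\<close>
lemma lift_zero_iff:
  "lift n q p \<zero>\<^bsub>obj A (n - 1)\<^esub> \<zero>\<^bsub>obj A (n - 1)\<^esub> \<longleftrightarrow>
    q \<in> carrier (obj B n) \<and> p \<in> carrier (obj B n) \<and> K_cl (obj B n) q p \<in> cycles (K_complex B) n"
proof (cases "q \<in> carrier (obj B n) \<and> p \<in> carrier (obj B n)")
  case True
  then show ?thesis using B.K_cl_cycle_iff[OF B_cancellative, of q n p] by (simp add: lift_def)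
qed (auto simp: lift_def)

text \<open>
  The cycle \<open>[q, p]\<close> of \<open>K(B)\<close> is mapped to \<open>[\<sigma>(q), \<sigma>(p)]\<close>, which is \<open>[c, 0]\<close> for
  \<open>c = \<sigma>(q) - \<sigma>(p)\<close> because \<open>G\<^sub>n\<close> is a group; this is the same \<open>c\<close> as in \<open>kernel_connecting\<close>.
\<close>
lemma image_kernel_connecting:
  "homology_map (K_complex G) n (\<lambda>k. K_unit (obj G k)) `
     a_kernel (homology G n) (homology A (n - 1)) (connecting A B \<kappa> \<sigma> n)
   = homology_map (K_complex G) n (\<lambda>k. K_map (obj G k) (\<sigma> k)) ` carrier (homology (K_complex B) n)"
    (is "?u ` ?K = ?k ` _")
proof -
  interpret unit: complex_map R G "K_ring R" "K_complex G" "\<lambda>k. K_unit (obj G k)"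
    by (rule G.K_unit_complex_map)
  interpret Ksigma: complex_map "K_ring R" "K_complex B" "K_ring R" "K_complex G" "\<lambda>k. K_map (obj G k) (\<sigma> k)"
    by (rule proj.K_map_complex_map[OF B_cancellative])
  have step: "?u (hcl G n c) = ?k (hcl (K_complex B) n (K_cl (obj B n) q p))"
    if c: "c \<in> cycles G n" "\<sigma> n q = c \<oplus>\<^bsub>obj G n\<^esub> \<sigma> n p"
      and l: "lift n q p \<zero>\<^bsub>obj A (n - 1)\<^esub> \<zero>\<^bsub>obj A (n - 1)\<^esub>" for c q p
  proof -
    note m = liftD(1,2)[OF l] G.cyclesD(1)[OF c(1)]
    have "K_map (obj G n) (\<sigma> n) (K_cl (obj B n) q p) = K_cl (obj G n) (\<sigma> n q) (\<sigma> n p)"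
      by (rule B.compl.K_map_K_cl[OF G.deg.semimodule_axioms]) (use m in auto)
    also have "\<dots> = K_unit (obj G n) c"
      unfolding K_unit_def using m c(2) by (intro G.deg.M.K_cl_eqI) (simp_all add: G.deg.M.a_ac)
    finally show ?thesis
      using c(1) l by (simp add: unit.homology_map_class Ksigma.homology_map_class lift_zero_iff)
  qed
  show ?thesis
  proof (intro equalityI subsetI)
    fix D assume "D \<in> ?u ` ?K"
    then obtain c q p where c: "c \<in> cycles G n" "\<sigma> n q = c \<oplus>\<^bsub>obj G n\<^esub> \<sigma> n p"
      "lift n q p \<zero>\<^bsub>obj A (n - 1)\<^esub> \<zero>\<^bsub>obj A (n - 1)\<^esub>" "D = ?u (hcl G n c)"
      unfolding kernel_connecting by blast
    then show "D \<in> ?k ` carrier (homology (K_complex B) n)"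
      using step[OF c(1-3)] by (auto simp: Ksigma.X.homology_carrier lift_zero_iff)
  next
    fix D assume "D \<in> ?k ` carrier (homology (K_complex B) n)"
    then obtain z where z: "z \<in> cycles (K_complex B) n" "D = ?k (hcl (K_complex B) n z)"
      by (auto simp: Ksigma.X.homology_carrier)
    then have "z \<in> carrier (K_module (obj B n))"
      using Ksigma.X.cyclesD(1) by (simp add: B.K_complex_simps)
    then obtain q p where q: "q \<in> carrier (obj B n)" "p \<in> carrier (obj B n)" "z = K_cl (obj B n) q p"
      by (rule B.compl.K_carrierE)
    then have l: "lift n q p \<zero>\<^bsub>obj A (n - 1)\<^esub> \<zero>\<^bsub>obj A (n - 1)\<^esub>" using z(1) lift_zero_iff by blast
    obtain c where c: "c \<in> cycles G n" "\<sigma> n q = c \<oplus>\<^bsub>obj G n\<^esub> \<sigma> n p" using lift_class[OF l] .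
    show "D \<in> ?u ` ?K"
      unfolding kernel_connecting using step[OF c l] z(2) q(3) c l by blast
  qed
qed

lemma exact_at_G_iff:
  "exact_at R (homology B n) (homology G n) (homology A (n - 1)) (homology_map G n \<sigma>) (connecting A B \<kappa> \<sigma> n)
   \<longleftrightarrow> homology_map (K_complex G) n (\<lambda>k. K_unit (obj G k)) ` (homology_map G n \<sigma> ` carrier (homology B n))
     = homology_map (K_complex G) n (\<lambda>k. K_map (obj G k) (\<sigma> k)) ` carrier (homology (K_complex B) n)"
proof -
  let ?K = "a_kernel (homology G n) (homology A (n - 1)) (connecting A B \<kappa> \<sigma> n)"
  have K: "?K \<subseteq> carrier (homology G n)" by (auto simp: a_kernel_def')
  have "exact_at R (homology B n) (homology G n) (homology A (n - 1)) (homology_map G n \<sigma>) (connecting A B \<kappa> \<sigma> n)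
    \<longleftrightarrow> homology_map G n \<sigma> ` carrier (homology B n) = ?K"
    unfolding exact_at_def using sigma_homology_hom connecting_hom by blast
  also have "\<dots> \<longleftrightarrow> homology_map (K_complex G) n (\<lambda>k. K_unit (obj G k)) ` (homology_map G n \<sigma> ` carrier (homology B n))
     = homology_map (K_complex G) n (\<lambda>k. K_unit (obj G k)) ` ?K"
    by (rule inj_on_image_eq_iff[OF G.inj_homology_K_unit[OF proj.target_cancellative]
          subset_trans[OF image_sigma_in_kernel K] K, symmetric])
  finally show ?thesis unfolding image_kernel_connecting .
qed

end

theorem theorem2p4:
  fixes \<Lambda> :: "('r, 'm) ring_scheme"
    and A :: "('r, 'a) semi_complex"
    and B :: "('r, 'b) semi_complex"
    and Gobj :: "int \<Rightarrow> ('r, 'c) module"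
    and \<delta> :: "int \<Rightarrow> 'c \<Rightarrow> 'c"
    and G :: "('r, 'c) semi_complex"
    and \<kappa> :: "int \<Rightarrow> 'a \<Rightarrow> 'b"
    and \<sigma> :: "int \<Rightarrow> 'b \<Rightarrow> 'c"
  defines "G \<equiv> complex_of Gobj \<delta>"
  assumes "semiring \<Lambda>"
    and "ordinary_chain_complex \<Lambda> Gobj \<delta>"
    and "schreier_ses \<Lambda> A B G \<kappa> \<sigma>"
    and "\<forall>n. cancellative (obj A n)"
    and "\<forall>n. dminus_preserves_representatives A B \<kappa> \<sigma> n"
    and "\<forall>n. abelian_group (Gobj n)"
  shows "\<forall>n::int.
      exact_at \<Lambda> (homology G (n + 1)) (homology A n) (homology B n)
        (connecting A B \<kappa> \<sigma> (n + 1)) (homology_map B n \<kappa>) \<and>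
      exact_at \<Lambda> (homology A n) (homology B n) (homology G n)
        (homology_map B n \<kappa>) (homology_map G n \<sigma>) \<and>
      homology_map G n \<sigma> ` carrier (homology B n)
        \<subseteq> a_kernel (homology G n) (homology A (n - 1)) (connecting A B \<kappa> \<sigma> n) \<and>
      normal_hom \<Lambda> (homology A n) (homology B n) (homology_map B n \<kappa>) \<and>
      (exact_at \<Lambda> (homology B n) (homology G n) (homology A (n - 1))
         (homology_map G n \<sigma>) (connecting A B \<kappa> \<sigma> n) \<longleftrightarrow>
       homology_map (K_complex G) n (\<lambda>k. K_unit (obj G k)) `
         (homology_map G n \<sigma> ` carrier (homology B n))
       = homology_map (K_complex G) n (\<lambda>k. K_map (obj G k) (\<sigma> k)) `
         carrier (homology (K_complex B) n))"
proof -
  interpret schreier_homology \<Lambda> A B G \<kappa> \<sigma>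
    using assms(4-7)
    by (intro schreier_homology.intro schreier_homology_axioms.intro semi_chain_complex.intro)
      (auto simp: G_def complex_of_def schreier_ses_def)
  show ?thesis
    using exact_at_A[of "n + 1" for n] normal_kappa[of "n + 1" for n]
      exact_at_B image_sigma_in_kernel exact_at_G_iff by simp
qed

end
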